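(* Let $K/k$ be a q-finite purely inseparable extension of unbounded exponent, and let $t=di(rp(K/k)/k)$. The following are equivalent: (1) $K/k$ is lq-modular; (2) there exists $j\in\mathbb{N}$ such that $K/(k^{p^{-j}}\cap K)$ is modular; (3) for every integer $s\in[1,t]$ the sequence $(U_s^j(K/k))_{j\in\mathbb{N}}$ is bounded; (4) $Ilqm(K/k)=t+1$.
   Context: All fields lie in a fixed algebraic closure $\Omega$ of a field $k$ of characteristic $p>0$; all extensions are purely inseparable. For a field $L$ and $n\ge0$, $L^{p^{-n}}=\{a\in\Omega: a^{p^n}\in L\}$. A minimal generating set of $K/k$ is $G\subseteq K$ with $K=k(G)$ and $x\notin k(G\setminus\{x\})$ for all $x\in G$; for extensions of finite exponent all minimal generating sets have the same cardinality. For $K/k$ put $k_n=k^{p^{-n}}\cap K$; the degree of irrationality is $di(K/k)=\sup_n |G_n|$, $G_n$ a minimal generating set of $k_n/k$. $K/k$ is q-finite if $di(K/k)<\infty$; it has bounded exponent if $K^{p^e}\subseteq k$ for some $e$. $K/k$ is relatively perfect if $k(K^p)=K$; $rp(K/k)$ denotes the largest relatively perfect subextension of $K/k$. $K/k$ is modular if for every $n\in\mathbb{N}$, $K^{p^n}$ and $k$ are $(k\cap K^{p^n})$-linearly disjoint. A q-finite $K/k$ is lq-modular if $K$ is modular over some finite subextension of $K/k$. For a finite purely inseparable extension $L/k$ and $s\ge1$, the $s$-th exponent is $o_s(L/k)=\inf\{m\in\mathbb{N}: di(k(L^{p^m})/k)<s\}$. For $K/k$ q-finite of unbounded exponent, $U_s^j(K/k)=j-o_s(k_j/k)$,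 and $Ilqm(K/k)$ is the smallest integer $s\ge1$ such that $(U_s^j(K/k))_{j\in\mathbb{N}}$ is unbounded. *)

theory Defs
  imports Main "HOL-Computational_Algebra.Polynomial" "HOL-Library.Extended_Nat"
begin

text \<open>The ambient field Omega is a type 'a of class field; its characteristic is CHAR('a).
  Subfields of Omega are represented as sets.\<close>

definition subfield :: "'a::field set \<Rightarrow> bool" where
  "subfield F \<longleftrightarrow> 0 \<in> F \<and> 1 \<in> F \<and>
     (\<forall>x\<in>F. \<forall>y\<in>F. x + y \<in> F \<and> x - y \<in> F \<and> x * y \<in> F) \<and>
     (\<forall>x\<in>F. inverse x \<in> F)"

definition gen :: "'a::field set \<Rightarrow> 'a set \<Rightarrow> 'a set" where
  "gen k G = \<Inter>{F. subfield F \<and> k \<union> G \<subseteq> F}"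

definition intermediate :: "'a::field set \<Rightarrow> 'a set \<Rightarrow> 'a set \<Rightarrow> bool" where
  "intermediate k L K \<longleftrightarrow> subfield L \<and> k \<subseteq> L \<and> L \<subseteq> K"

definition proot :: "'a::field set \<Rightarrow> nat \<Rightarrow> 'a set" where
  "proot L n = {a. a ^ (CHAR('a) ^ n) \<in> L}"

definition ppow :: "'a::field set \<Rightarrow> nat \<Rightarrow> 'a set" where
  "ppow L n = (\<lambda>x. x ^ (CHAR('a) ^ n)) ` L"

definition purely_inseparable :: "'a::field set \<Rightarrow> 'a set \<Rightarrow> bool" where
  "purely_inseparable k K \<longleftrightarrow> (\<forall>x\<in>K. \<exists>n. x ^ (CHAR('a) ^ n) \<in> k)"

definition bounded_exponent :: "'a::field set \<Rightarrow> 'a set \<Rightarrow> bool" where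
  "bounded_exponent k K \<longleftrightarrow> (\<exists>e. ppow K e \<subseteq> k)"

definition kn :: "'a::field set \<Rightarrow> 'a set \<Rightarrow> nat \<Rightarrow> 'a set" where
  "kn k K n = proot k n \<inter> K"

definition min_gen_set :: "'a::field set \<Rightarrow> 'a set \<Rightarrow> 'a set \<Rightarrow> bool" where
  "min_gen_set k K G \<longleftrightarrow> G \<subseteq> K \<and> gen k G = K \<and> (\<forall>x\<in>G. x \<notin> gen k (G - {x}))"

definition ecard :: "'a set \<Rightarrow> enat" where
  "ecard G = (if finite G then enat (card G) else \<infinity>)"

text \<open>Cardinality of a minimal generating set (all such have the same cardinality for
  extensions of finite exponent; we take the infimum to avoid a choice).\<close>
definition mgs_card :: "'a::field set \<Rightarrow> 'a set \<Rightarrow> enat" where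
  "mgs_card k K = (INF G\<in>{G. min_gen_set k K G}. ecard G)"

definition di :: "'a::field set \<Rightarrow> 'a set \<Rightarrow> enat" where
  "di k K = (SUP n. mgs_card k (kn k K n))"

definition q_finite :: "'a::field set \<Rightarrow> 'a set \<Rightarrow> bool" where
  "q_finite k K \<longleftrightarrow> di k K < \<infinity>"

definition rel_perfect :: "'a::field set \<Rightarrow> 'a set \<Rightarrow> bool" where
  "rel_perfect k K \<longleftrightarrow> gen k (ppow K 1) = K"

definition rp :: "'a::field set \<Rightarrow> 'a set \<Rightarrow> 'a set" where
  "rp k K = (THE L. intermediate k L K \<and> rel_perfect k L \<and>
      (\<forall>L'. intermediate k L' K \<and> rel_perfect k L' \<longrightarrow> L' \<subseteq> L))"

definition lin_indep_over :: "'a::field set \<Rightarrow> 'a set \<Rightarrow> bool" where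
  "lin_indep_over F S \<longleftrightarrow> (\<forall>T c. T \<subseteq> S \<longrightarrow> finite T \<longrightarrow> (\<forall>x\<in>T. c x \<in> F) \<longrightarrow>
      (\<Sum>x\<in>T. c x * x) = 0 \<longrightarrow> (\<forall>x\<in>T. c x = 0))"

definition lin_disjoint :: "'a::field set \<Rightarrow> 'a set \<Rightarrow> 'a set \<Rightarrow> bool" where
  "lin_disjoint C A B \<longleftrightarrow> (\<forall>S\<subseteq>A. lin_indep_over C S \<longrightarrow> lin_indep_over B S)"

definition modular :: "'a::field set \<Rightarrow> 'a set \<Rightarrow> bool" where
  "modular k K \<longleftrightarrow> (\<forall>n. lin_disjoint (k \<inter> ppow K n) (ppow K n) k)"

definition span_over :: "'a::field set \<Rightarrow> 'a set \<Rightarrow> 'a set" where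
  "span_over F B = {y. \<exists>c. (\<forall>x\<in>B. c x \<in> F) \<and> y = (\<Sum>x\<in>B. c x * x)}"

definition finite_ext :: "'a::field set \<Rightarrow> 'a set \<Rightarrow> bool" where
  "finite_ext k L \<longleftrightarrow> (\<exists>B. finite B \<and> B \<subseteq> L \<and> L \<subseteq> span_over k B)"

definition lq_modular :: "'a::field set \<Rightarrow> 'a set \<Rightarrow> bool" where
  "lq_modular k K \<longleftrightarrow> q_finite k K \<and>
     (\<exists>L. intermediate k L K \<and> finite_ext k L \<and> modular L K)"

definition o_exp :: "nat \<Rightarrow> 'a::field set \<Rightarrow> 'a set \<Rightarrow> nat" where
  "o_exp s k L = (LEAST m. di k (gen k (ppow L m)) < enat s)"

definition U :: "nat \<Rightarrow> nat \<Rightarrow> 'a::field set \<Rightarrow> 'a set \<Rightarrow> int" where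
  "U s j k K = int j - int (o_exp s k (kn k K j))"

definition U_bounded :: "nat \<Rightarrow> 'a::field set \<Rightarrow> 'a set \<Rightarrow> bool" where
  "U_bounded s k K \<longleftrightarrow> (\<exists>B. \<forall>j. \<bar>U s j k K\<bar> \<le> B)"

definition Ilqm :: "'a::field set \<Rightarrow> 'a set \<Rightarrow> nat" where
  "Ilqm k K = (LEAST s. 1 \<le> s \<and> \<not> U_bounded s k K)"

end

theory Submission
  imports "HOL-Algebra.Embedded_Algebras" Defs
begin

text \<open>
  For a finite purely inseparable extension \<open>L/k\<close> the size \<open>r\<close> of a minimal generating set satisfies
  \<open>p\<^sup>r = [L : k(L\<^sup>p)]\<close>. Put \<open>D j m\<close> for this number attached to \<open>k(k\<^sub>j\<^bsup>p^m\<^esup>)\<close>. It increases with \<open>j\<close>,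
  decreases with \<open>m\<close>, and for large \<open>m\<close> its maximum over \<open>j\<close> is a constant \<open>t\<close>; then
  \<open>rp(K/k) = k(K\<^bsup>p^m\<^esup>)\<close> has irrationality degree \<open>t\<close>. All four conditions are equivalent to the existence
  of \<open>c\<close> with \<open>D j m \<ge> t\<close> whenever \<open>m + c < j\<close>. If \<open>K\<close> is modular over a finite \<open>L\<close>, linear
  disjointness makes the analogue of \<open>D j m\<close> over \<open>L\<close> independent of \<open>j > m\<close>, and passing from \<open>L\<close> to
  \<open>k\<close> only shifts the indices by the exponent of \<open>L/k\<close>. Conversely, for large \<open>l\<close> every
  \<open>k\<^bsub>l+j\<^esub>/k\<^sub>l\<close> has rank at most \<open>t\<close>, so \<open>[k\<^bsub>l+j\<^esub> : k\<^sub>l] \<le> p\<^bsup>tj\<^esup>\<close>, while the lower bound on \<open>D\<close> forces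
  equality for large \<open>l\<close>; a degree count then yields the linear disjointness over \<open>k\<^sub>l\<close>.
\<close>

section \<open>Linear algebra over a subfield\<close>

text \<open>Both directions are degree counts. Since \<open>k \<inter> ppow K m\<close> is the
  Frobenius image of k_m, linear disjointness at level m gives [E j m : k] = [k_j : k_m] for all j
  >= m; dividing the cases m and m+1 leaves p^(D j m) = [k_(m+1) : k_m], which is free of j. As D j
  m counts the s with o_s(k_j/k) > m, boundedness of the U_s is a statement about D alone. The
  obstacle is that D is formed over \<open>k\<close> while modularity is only available over a
  larger finite base, and D changes with the base. The two versions are comparable only after shifts
  by the exponent of the base; this is the origin of the slack \<open>c\<close>. For the converse a
  base must be found. Over rp(K/k) the fields k_j generate extensions of bounded degree, so some k_i
  generates K over rp(K/k), and from i on each step k_(j+1)/k_j has rank at most t. Hence tj - log_p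
  [k_j : k] is nondecreasing from i on; the slack bounds it by tc, so it becomes constant, and an
  index where it has stopped growing serves as the base.\<close>

definition type_ring :: "'a::field ring" where
  "type_ring = \<lparr>carrier = UNIV, monoid.mult = (*), one = 1, zero = 0, add = (+)\<rparr>"

lemma type_ring_simps [simp]:
  "carrier type_ring = UNIV" "monoid.mult type_ring = (*)" "monoid.one type_ring = 1"
  "ring.zero type_ring = 0" "ring.add type_ring = (+)"
  by (simp_all add: type_ring_def)

text \<open>Viewing the whole type as a HOL-Algebra field makes the list-based dimension theory over
  subfields available; with carrier \<open>UNIV\<close> its carrier conditions are trivial. The
  lemmas below translate between lists there and sets here.\<close>

interpretation T: Ring.field "type_ring :: 'a::field ring"
proof (rule cring.cring_fieldI2)
  show "cring (type_ring :: 'a ring)"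
  proof (intro cringI abelian_groupI comm_monoidI)
    fix x :: 'a
    show "\<exists>y\<in>carrier type_ring. y \<oplus>\<^bsub>type_ring\<^esub> x = \<zero>\<^bsub>type_ring\<^esub>"
      by (rule bexI[of _ "- x"]) auto
  qed (auto simp: algebra_simps)
  fix x :: 'a assume "x \<in> carrier type_ring" "x \<noteq> \<zero>\<^bsub>type_ring\<^esub>"
  then show "\<exists>y\<in>carrier type_ring. x \<otimes>\<^bsub>type_ring\<^esub> y = \<one>\<^bsub>type_ring\<^esub>"
    by (intro bexI[of _ "inverse x"]) auto
qed auto

lemma subfieldD:
  assumes "subfield F"
  shows "0 \<in> F" "1 \<in> F" "x \<in> F \<Longrightarrow> y \<in> F \<Longrightarrow> x + y \<in> F" "x \<in> F \<Longrightarrow> y \<in> F \<Longrightarrow> x - y \<in> F"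
    "x \<in> F \<Longrightarrow> y \<in> F \<Longrightarrow> x * y \<in> F" "x \<in> F \<Longrightarrow> inverse x \<in> F" "x \<in> F \<Longrightarrow> - x \<in> F"
    "x \<in> F \<Longrightarrow> y \<in> F \<Longrightarrow> x / y \<in> F" "x \<in> F \<Longrightarrow> x ^ n \<in> F"
proof -
  show 1: "0 \<in> F" "1 \<in> F" "x \<in> F \<Longrightarrow> y \<in> F \<Longrightarrow> x + y \<in> F" "x \<in> F \<Longrightarrow> y \<in> F \<Longrightarrow> x - y \<in> F"
    and 2: "x \<in> F \<Longrightarrow> y \<in> F \<Longrightarrow> x * y \<in> F" "x \<in> F \<Longrightarrow> inverse x \<in> F" for x y
    using assms by (auto simp: subfield_def)
  show "x \<in> F \<Longrightarrow> - x \<in> F" using 1(4)[of 0 x] 1(1) by simp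
  show "x \<in> F \<Longrightarrow> y \<in> F \<Longrightarrow> x / y \<in> F" using 2 by (simp add: divide_inverse)
  show "x \<in> F \<Longrightarrow> x ^ n \<in> F" by (induction n) (use 1 2 in auto)
qed

lemma subfield_sum: "subfield F \<Longrightarrow> (\<And>x. x \<in> A \<Longrightarrow> f x \<in> F) \<Longrightarrow> sum f A \<in> F"
  by (induction A rule: infinite_finite_induct) (auto intro: subfieldD)

lemma subfield_type_ring:
  assumes F: "subfield F" shows "Subrings.subfield F type_ring"
proof -
  have neg: "a_inv type_ring x = - x" for x :: 'a
    using T.minus_equality[of "- x" x] by simp
  have inv: "m_inv type_ring x = inverse x" if "x \<noteq> 0" for x :: 'a
    using T.comm_inv_char[of x "inverse x"] that by simp
  show ?thesis
    by (rule T.subfieldI'[OF T.subringI]) (use F in \<open>auto simp: neg inv intro: subfieldD\<close>)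
qed

lemma combine_map:
  "distinct Us \<Longrightarrow> T.combine (map c Us) Us = (\<Sum>x\<in>set Us. c x * (x :: 'a::field))"
  by (induction Us) auto

lemma list_eq_map:
  "length Ks = length Us \<Longrightarrow> distinct Us \<Longrightarrow> \<exists>c. Ks = map c Us"
proof (induction Ks Us rule: list_induct2)
  case (Cons k Ks u Us)
  then obtain c where "Ks = map c Us" by auto
  with Cons show ?case by (intro exI[of _ "c(u := k)"]) auto
qed simp

lemma Span_eq_span_over:
  fixes F :: "'a::field set"
  assumes F: "subfield F" and d: "distinct Us"
  shows "T.Span F Us = span_over F (set Us)"
proof -
  have "T.Span F Us = {T.combine Ks Us |Ks. length Ks = length Us \<and> set Ks \<subseteq> F}"
    using T.Span_eq_combine_set_length_version[OF subfield_type_ring[OF F]] by simp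
  also have "\<dots> = span_over F (set Us)"
  proof (intro equalityI subsetI)
    fix y assume "y \<in> {T.combine Ks Us |Ks. length Ks = length Us \<and> set Ks \<subseteq> F}"
    then obtain Ks where K: "y = T.combine Ks Us" "length Ks = length Us" "set Ks \<subseteq> F" by auto
    from list_eq_map[OF K(2) d] obtain c where c: "Ks = map c Us" by blast
    show "y \<in> span_over F (set Us)"
      unfolding span_over_def using K c combine_map[OF d] by auto
  next
    fix y assume "y \<in> span_over F (set Us)"
    then obtain c where "\<forall>x\<in>set Us. c x \<in> F" "y = (\<Sum>x\<in>set Us. c x * x)"
      unfolding span_over_def by blast
    then show "y \<in> {T.combine Ks Us |Ks. length Ks = length Us \<and> set Ks \<subseteq> F}"
      using combine_map[OF d, of c] by (auto intro!: exI[of _ "map c Us"])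
  qed
  finally show ?thesis .
qed

lemma lin_indep_overI:
  assumes "\<And>T c. T \<subseteq> S \<Longrightarrow> finite T \<Longrightarrow> (\<And>x. x \<in> T \<Longrightarrow> c x \<in> F) \<Longrightarrow>
    (\<Sum>x\<in>T. c x * x) = 0 \<Longrightarrow> (\<And>x. x \<in> T \<Longrightarrow> c x = 0)"
  shows "lin_indep_over F S"
  unfolding lin_indep_over_def using assms by simp

lemma lin_indep_overD:
  assumes "lin_indep_over F S" "T \<subseteq> S" "finite T" "\<And>x. x \<in> T \<Longrightarrow> c x \<in> F"
    "(\<Sum>x\<in>T. c x * x) = 0" "x \<in> T"
  shows "c x = 0"
  using assms(1)[unfolded lin_indep_over_def, THEN spec[of _ T], THEN spec[of _ c]] assms(2-) by simp

lemma lin_indep_over_finiteI: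
  assumes F: "subfield F" and B: "finite B"
    and *: "\<And>c. (\<And>x. x \<in> B \<Longrightarrow> c x \<in> F) \<Longrightarrow> (\<Sum>x\<in>B. c x * x) = 0 \<Longrightarrow> (\<And>x. x \<in> B \<Longrightarrow> c x = 0)"
  shows "lin_indep_over F B"
proof (rule lin_indep_overI)
  fix T c x assume T: "T \<subseteq> B" "finite T" "\<And>x. x \<in> T \<Longrightarrow> c x \<in> F" "(\<Sum>x\<in>T. c x * x) = 0" "x \<in> T"
  let ?c = "\<lambda>x. if x \<in> T then c x else 0"
  have "(\<Sum>x\<in>B. ?c x * x) = (\<Sum>x\<in>T. c x * x)"
    using T(1,2) B by (intro sum.mono_neutral_cong_right) auto
  then show "c x = 0"
    using *[of ?c x] T subfieldD(1)[OF F] by auto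
qed

lemma lin_indep_over_mono: "lin_indep_over F S \<Longrightarrow> S' \<subseteq> S \<Longrightarrow> lin_indep_over F S'"
  by (rule lin_indep_overI, erule lin_indep_overD) auto

lemma lin_indep_over_finite_subsets:
  assumes "\<And>S'. finite S' \<Longrightarrow> S' \<subseteq> S \<Longrightarrow> lin_indep_over F S'"
  shows "lin_indep_over F S"
proof (rule lin_indep_overI)
  fix T c x assume T: "T \<subseteq> S" "finite T" "\<And>x. x \<in> T \<Longrightarrow> c x \<in> F" "(\<Sum>x\<in>T. c x * x) = 0" "x \<in> T"
  show "c x = 0"
    by (rule lin_indep_overD[OF assms[OF T(2,1)] subset_refl T(2-5)])
qed

lemma independent_iff:
  fixes F :: "'a::field set"
  assumes F: "subfield F"
  shows "T.independent F Us \<longleftrightarrow> distinct Us \<and> lin_indep_over F (set Us)"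
proof
  assume i: "T.independent F Us"
  have d: "distinct Us" using T.independent_distinct[OF subfield_type_ring[OF F] i] .
  have "lin_indep_over F (set Us)"
  proof (rule lin_indep_over_finiteI[OF F finite_set])
    fix c x assume c: "\<And>x. x \<in> set Us \<Longrightarrow> c x \<in> F" "(\<Sum>x\<in>set Us. c x * x) = 0" "x \<in> set Us"
    have "set (map c Us) \<subseteq> F" using c(1) by auto
    moreover have "T.combine (map c Us) Us = \<zero>\<^bsub>type_ring\<^esub>"
      using combine_map[OF d, of c] c(2) by simp
    ultimately have "set (take (length Us) (map c Us)) \<subseteq> {\<zero>\<^bsub>type_ring\<^esub>}"
      by (rule T.independent_imp_trivial_combine[OF subfield_type_ring[OF F] i])
    then show "c x = 0" using c(3) by auto
  qed
  with d show "distinct Us \<and> lin_indep_over F (set Us)" ..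
next
  assume i: "distinct Us \<and> lin_indep_over F (set Us)"
  then have d: "distinct Us" and li: "lin_indep_over F (set Us)" by auto
  show "T.independent F Us"
  proof (rule ccontr)
    assume dep: "\<not> T.independent F Us"
    obtain Ks where K: "length Ks = length Us" "T.combine Ks Us = \<zero>\<^bsub>type_ring\<^esub>" "set Ks \<subseteq> F"
      "set Ks \<noteq> {\<zero>\<^bsub>type_ring\<^esub>}"
      by (rule T.dependent_imp_non_trivial_combine[OF subfield_type_ring[OF F] _ dep]) auto
    from list_eq_map[OF K(1) d] obtain c where c: "Ks = map c Us" by (elim exE)
    have "c x = 0" if "x \<in> set Us" for x
    proof (rule lin_indep_overD[OF li subset_refl finite_set _ _ that])
      show "c x \<in> F" if "x \<in> set Us" for x using K(3) c that by auto
      show "(\<Sum>x\<in>set Us. c x * x) = 0" using combine_map[OF d, of c] K(2) c by simp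
    qed
    then have "set Ks \<subseteq> {0}" using c by auto
    then have "Us = []" using K(1,4) by (cases Ks) auto
    then show False using dep T.li_Nil by simp
  qed
qed

text \<open>A relation instead of a function, so that finite dimensionality is part of the assertion
  and no junk value arises.\<close>

definition vdim :: "nat \<Rightarrow> 'a::field set \<Rightarrow> 'a set \<Rightarrow> bool" where
  "vdim n F V \<longleftrightarrow> (\<exists>B. finite B \<and> card B = n \<and> lin_indep_over F B \<and> V = span_over F B)"

lemma vdim_iff_dimension:
  assumes F: "subfield F"
  shows "vdim n F V \<longleftrightarrow> T.dimension n F V"
proof
  assume "vdim n F V"
  then obtain B where B: "finite B" "card B = n" "lin_indep_over F B" "V = span_over F B"
    unfolding vdim_def by (elim exE conjE)
  obtain Us where Us: "set Us = B" "distinct Us" using finite_distinct_list[OF B(1)] by (elim exE conjE)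
  have "T.independent F Us" using independent_iff[OF F] Us B by auto
  moreover have "T.Span F Us = V" using Span_eq_span_over[OF F] Us B by auto
  moreover have "length Us = n" using Us B distinct_card by fastforce
  ultimately show "T.dimension n F V" using T.dimensionI[OF subfield_type_ring[OF F]] by blast
next
  assume "T.dimension n F V"
  then obtain Us where "T.independent F Us" "length Us = n" "T.Span F Us = V"
    using T.exists_base[OF subfield_type_ring[OF F]] by metis
  then show "vdim n F V"
    unfolding vdim_def independent_iff[OF F] using Span_eq_span_over[OF F]
    by (intro exI[of _ "set Us"]) (simp add: distinct_card)
qed

lemma vdim_unique: "subfield F \<Longrightarrow> vdim n F V \<Longrightarrow> vdim m F V \<Longrightarrow> n = m"
  using T.dimension_is_inj[OF subfield_type_ring] vdim_iff_dimension by metis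

lemma vdim_indep_card:
  assumes F: "subfield F" and V: "vdim n F V" and S: "lin_indep_over F S" "S \<subseteq> V"
  shows "finite S" "card S \<le> n"
proof -
  have *: "card S' \<le> n" if "finite S'" "S' \<subseteq> S" for S'
  proof -
    obtain Us where Us: "set Us = S'" "distinct Us" using finite_distinct_list[OF \<open>finite S'\<close>] by (elim exE conjE)
    have "T.independent F Us" using independent_iff[OF F] Us lin_indep_over_mono[OF S(1)] that by auto
    then have "length Us \<le> n"
      using T.independent_length_le_dimension[OF subfield_type_ring[OF F]] V vdim_iff_dimension[OF F] Us S that
      by blast
    then show ?thesis using Us distinct_card by fastforce
  qed
  show "finite S"
  proof (rule ccontr)
    assume "infinite S"
    then obtain S' where "S' \<subseteq> S" "finite S'" "card S' = Suc n"
      using infinite_arbitrarily_large by blast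
    then show False using *[of S'] by simp
  qed
  then show "card S \<le> n" using * by blast
qed

lemma vdim_extend_basis:
  assumes F: "subfield F" and V: "vdim n F V" and S: "lin_indep_over F S" "S \<subseteq> V"
  obtains B where "S \<subseteq> B" "finite B" "card B = n" "lin_indep_over F B" "V = span_over F B"
proof -
  obtain Us where Us: "set Us = S" "distinct Us"
    using finite_distinct_list[OF vdim_indep_card(1)[OF assms]] by (elim exE conjE)
  have "T.independent F Us" using independent_iff[OF F] Us S by auto
  then obtain Vs where "length (Vs @ Us) = n" "T.independent F (Vs @ Us)" "T.Span F (Vs @ Us) = V"
    using T.complete_base[OF subfield_type_ring[OF F]] V vdim_iff_dimension[OF F] Us S by metis
  then have Vs: "distinct (Vs @ Us)" "lin_indep_over F (set (Vs @ Us))"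
    "span_over F (set (Vs @ Us)) = V" "length (Vs @ Us) = n"
    using independent_iff[OF F, of "Vs @ Us"] Span_eq_span_over[OF F, of "Vs @ Us"] by auto
  show thesis
  proof (rule that[of "set (Vs @ Us)"])
    show "S \<subseteq> set (Vs @ Us)" using Us by simp
    show "card (set (Vs @ Us)) = n" using distinct_card[OF Vs(1)] Vs(4) by simp
  qed (use Vs in auto)
qed

text \<open>Discarding each vector that lies in the span of the later ones leaves a basis. The
  dichotomy is what later turns an equality of degrees into linear independence: a spanning list as
  long as the dimension must be independent.\<close>

lemma dimension_Span:
  fixes F :: "'a::field set"
  assumes F: "subfield F"
  shows "\<exists>n. T.dimension n F (T.Span F Us) \<and>
           (n < length Us \<or> n = length Us \<and> T.independent F Us)"
proof (induction Us)
  case Nil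
  show ?case using T.zero_dim[of F] T.li_Nil[of F] by auto
next
  case (Cons u Us)
  then obtain n where n: "T.dimension n F (T.Span F Us)"
    "n < length Us \<or> n = length Us \<and> T.independent F Us" by blast
  show ?case
  proof (cases "u \<in> T.Span F Us")
    case True
    have "set (u # Us) \<subseteq> T.Span F Us"
      using True T.Span_base_incl[OF subfield_type_ring[OF F], of Us] by simp
    then have "T.Span F (u # Us) \<subseteq> T.Span F Us"
      using T.mono_Span_subset[OF subfield_type_ring[OF F], of "u # Us" Us] by simp
    moreover have "T.Span F Us \<subseteq> T.Span F (u # Us)"
      using T.mono_Span[OF subfield_type_ring[OF F], of Us u] by simp
    ultimately have "T.Span F (u # Us) = T.Span F Us" by (rule antisym)
    moreover have "n < length (u # Us)" using n(2) by auto
    ultimately show ?thesis using n(1) by metis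
  next
    case False
    then have "T.dimension (Suc n) F (T.Span F (u # Us))"
      using T.Suc_dim[of u "T.Span F Us" n F] n by simp
    moreover have "T.independent F (u # Us)" if "T.independent F Us"
      using T.li_Cons[of u F Us] that False by simp
    ultimately show ?thesis using n(2) by auto
  qed
qed

lemma vdim_span_over:
  assumes F: "subfield F" and B: "finite B"
  obtains n where "vdim n F (span_over F B)" "n < card B \<or> n = card B \<and> lin_indep_over F B"
proof -
  obtain Us where Us: "set Us = B" "distinct Us"
    using finite_distinct_list[OF B] by (elim exE conjE)
  have len: "length Us = card B" using distinct_card[OF Us(2)] Us(1) by simp
  from dimension_Span[OF F, of Us] obtain n where
    "T.dimension n F (T.Span F Us) \<and> (n < length Us \<or> n = length Us \<and> T.independent F Us)" ..
  then have n: "T.dimension n F (T.Span F Us)"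
    and *: "n < length Us \<or> n = length Us \<and> T.independent F Us" by blast+
  show thesis
  proof (rule that)
    show "vdim n F (span_over F B)"
      using n unfolding vdim_iff_dimension[OF F] Span_eq_span_over[OF F Us(2)] Us(1) .
    show "n < card B \<or> n = card B \<and> lin_indep_over F B"
      using * unfolding independent_iff[OF F] Us(1) len by blast
  qed
qed

lemma vdim_tower:
  assumes "subfield F" "subfield M" "vdim n F M" "vdim m M L"
  shows "vdim (n * m) F L"
  using T.telescopic_base[OF subfield_type_ring[OF assms(1)] subfield_type_ring[OF assms(2)]] assms(3,4)
  by (simp only: vdim_iff_dimension[OF assms(1)] vdim_iff_dimension[OF assms(2)])

lemma vdim_subspace:
  assumes F: "subfield F" and V: "vdim n F V" and W: "W \<subseteq> V" "0 \<in> W"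
    "\<And>x y. x \<in> W \<Longrightarrow> y \<in> W \<Longrightarrow> x + y \<in> W" "\<And>c x. c \<in> F \<Longrightarrow> x \<in> W \<Longrightarrow> c * x \<in> W"
  obtains m where "vdim m F W"
proof -
  have neg: "a_inv type_ring x = - x" for x :: 'a
    using T.minus_equality[of "- x" x] by simp
  have inv: "a_inv type_ring a \<in> W" if "a \<in> W" for a
    using W(4)[of "- 1" a] that subfieldD(7)[OF F subfieldD(2)[OF F]] neg[of a] by simp
  have "subgroup W (add_monoid type_ring)"
    by (rule T.add.subgroupI) (use W inv in auto)
  then have "subalgebra F W type_ring"
    by (rule subalgebra.intro) (use W in \<open>auto intro: subalgebra_axioms.intro\<close>)
  then have "T.finite_dimension F W"
    using T.subalbegra_incl_imp_finite_dimension[OF subfield_type_ring[OF F] T.finite_dimensionI _ W(1)] V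
    by (simp only: vdim_iff_dimension[OF F])
  then show thesis
    using that unfolding T.finite_dimension_def vdim_iff_dimension[OF F] by blast
qed

section \<open>Generated fields and the Frobenius map\<close>

lemma subfieldI:
  assumes "0 \<in> F" "1 \<in> F" "\<And>x y. x \<in> F \<Longrightarrow> y \<in> F \<Longrightarrow> x + y \<in> F"
    "\<And>x y. x \<in> F \<Longrightarrow> y \<in> F \<Longrightarrow> x - y \<in> F" "\<And>x y. x \<in> F \<Longrightarrow> y \<in> F \<Longrightarrow> x * y \<in> F"
    "\<And>x. x \<in> F \<Longrightarrow> inverse x \<in> F"
  shows "subfield F"
  using assms by (simp add: subfield_def)

lemma subfield_Inter: "(\<And>F. F \<in> \<F> \<Longrightarrow> subfield F) \<Longrightarrow> subfield (\<Inter>\<F>)"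
  unfolding subfield_def by blast

lemma subfield_Int: "subfield F \<Longrightarrow> subfield F' \<Longrightarrow> subfield (F \<inter> F')"
  unfolding subfield_def by blast

lemma subfield_gen [simp]: "subfield (gen k G)"
  unfolding gen_def by (rule subfield_Inter) auto

lemma gen_base: "k \<subseteq> gen k G"
  unfolding gen_def by blast

lemma gen_superset: "G \<subseteq> gen k G"
  unfolding gen_def by blast

lemma gen_least: "subfield F \<Longrightarrow> k \<subseteq> F \<Longrightarrow> G \<subseteq> F \<Longrightarrow> gen k G \<subseteq> F"
  unfolding gen_def by blast

lemma gen_mono: "k \<subseteq> k' \<Longrightarrow> G \<subseteq> G' \<Longrightarrow> gen k G \<subseteq> gen k' G'"
  unfolding gen_def by blast

lemma gen_absorb: "subfield k \<Longrightarrow> G \<subseteq> k \<Longrightarrow> gen k G = k"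
  using gen_least[of k k G] gen_base[of k G] by blast

lemma gen_gen: "gen (gen k G) H = gen k (G \<union> H)"
proof (rule antisym)
  show "gen (gen k G) H \<subseteq> gen k (G \<union> H)"
    by (intro gen_least gen_mono) (use gen_superset[of "G \<union> H" k] in auto)
  show "gen k (G \<union> H) \<subseteq> gen (gen k G) H"
    using gen_base[of k G] gen_superset[of G k] gen_base[of "gen k G" H] gen_superset[of H "gen k G"]
    by (intro gen_least) auto
qed

lemma gen_eqI: "subfield L \<Longrightarrow> k \<subseteq> L \<Longrightarrow> G \<subseteq> L \<Longrightarrow> L \<subseteq> gen k G \<Longrightarrow> gen k G = L"
  using gen_least[of L k G] by blast

section \<open>Polynomials with coefficients in a subfield\<close>

definition poly_over :: "'a::field set \<Rightarrow> 'a poly \<Rightarrow> bool" where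
  "poly_over F f \<longleftrightarrow> (\<forall>i. coeff f i \<in> F)"

lemma poly_over_arith:
  assumes F: "subfield F" and "poly_over F f" "poly_over F g"
  shows "poly_over F (f + g)" "poly_over F (f - g)" "poly_over F (f * g)"
  using assms by (auto simp: poly_over_def coeff_mult intro!: subfieldD[OF F] subfield_sum[OF F])

lemma poly_over_monom: "subfield F \<Longrightarrow> c \<in> F \<Longrightarrow> poly_over F (monom c n)"
  by (auto simp: poly_over_def dest: subfieldD)

lemma subfield_of_nat: "subfield F \<Longrightarrow> of_nat n \<in> F"
  by (induction n) (auto intro: subfieldD)

lemma poly_over_pderiv: "subfield F \<Longrightarrow> poly_over F f \<Longrightarrow> poly_over F (pderiv f)"
  unfolding poly_over_def coeff_pderiv
  by (metis subfieldD(5) subfield_of_nat)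

text \<open>The usual cancellation of leading terms, carried out so that every coefficient visibly
  stays in \<open>F\<close>.\<close>

lemma poly_over_division:
  fixes F :: "'a::field set"
  assumes F: "subfield F" and f: "poly_over F f" "f \<noteq> 0"
  shows "poly_over F g \<Longrightarrow>
    \<exists>q r. g = f * q + r \<and> poly_over F q \<and> poly_over F r \<and> (r = 0 \<or> degree r < degree f)"
proof (induction "degree g" arbitrary: g rule: less_induct)
  case less
  show ?case
  proof (cases "g = 0 \<or> degree g < degree f")
    case True
    then show ?thesis
      using less(2) subfieldD(1)[OF F] by (intro exI[of _ 0] exI[of _ g]) (auto simp: poly_over_def)
  next
    case False
    then have deg: "degree f \<le> degree g" by auto
    define m where "m = monom (lead_coeff g / lead_coeff f) (degree g - degree f)"
    have m: "poly_over F m"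
      using f less(2) unfolding m_def poly_over_def[of _ f] poly_over_def[of _ g]
      by (intro poly_over_monom[OF F] subfieldD[OF F]) auto
    have mf: "m * f \<noteq> 0" "degree (m * f) = degree g" "coeff (m * f) (degree g) = lead_coeff g"
    proof -
      have "lead_coeff g / lead_coeff f \<noteq> 0" using False f by auto
      then have m0: "m \<noteq> 0" "degree m = degree g - degree f"
        "lead_coeff m = lead_coeff g / lead_coeff f"
        unfolding m_def by (auto simp: degree_monom_eq)
      then show "m * f \<noteq> 0" and d: "degree (m * f) = degree g"
        using f deg by (auto simp: degree_mult_eq)
      show "coeff (m * f) (degree g) = lead_coeff g"
        using lead_coeff_mult[of m f] d m0 f by simp
    qed
    define g' where "g' = g - m * f"
    have g': "poly_over F g'"
      unfolding g'_def using poly_over_arith[OF F] m f less(2) by blast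
    have "degree g' \<le> degree g" unfolding g'_def using mf by (intro degree_diff_le) auto
    moreover have "coeff g' (degree g) = 0" unfolding g'_def using mf by simp
    ultimately have "g' = 0 \<or> degree g' < degree g" by (rule eq_zero_or_degree_less)
    then have "\<exists>q r. g' = f * q + r \<and> poly_over F q \<and> poly_over F r \<and> (r = 0 \<or> degree r < degree f)"
    proof
      assume "g' = 0"
      then show ?thesis
        using subfieldD(1)[OF F] by (intro exI[of _ 0]) (auto simp: poly_over_def)
    qed (use less(1) g' in blast)
    then obtain q r where "g' = f * q + r" "poly_over F q" "poly_over F r" "r = 0 \<or> degree r < degree f"
      by blast
    moreover have "g = f * (m + q) + r" using calculation(1) unfolding g'_def by (simp add: algebra_simps)
    moreover have "poly_over F (m + q)" using poly_over_arith[OF F m] calculation by blast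
    ultimately show ?thesis by blast
  qed
qed

text \<open>In effect the minimal polynomial of a p-th root outside \<open>F\<close> has degree p;
  this is what makes 1, x, ..., x^(p-1) independent over \<open>F\<close>.\<close>

lemma poly_nonzero_below_CHAR:
  fixes x :: "'a::field"
  assumes p: "CHAR('a) > 0" and F: "subfield F" and x: "x ^ CHAR('a) \<in> F" "x \<notin> F"
    and g: "poly_over F g" "g \<noteq> 0" "degree g < CHAR('a)"
  shows "poly g x \<noteq> 0"
proof
  assume gx: "poly g x = 0"
  let ?p = "CHAR('a)"
  have prime: "prime ?p" using prime_CHAR_semidom[OF p] .
  define P where "P f \<longleftrightarrow> poly_over F f \<and> f \<noteq> 0 \<and> poly f x = 0" for f
  obtain f where f: "P f" and min: "\<And>h. P h \<Longrightarrow> degree f \<le> degree h"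
    using ex_has_least_nat[of P g degree] gx g(1,2) unfolding P_def by auto
  have fF: "poly_over F f" "f \<noteq> 0" and fx: "poly f x = 0" and degf: "degree f < ?p"
    using f min[of g] g gx unfolding P_def by auto
  have minD: "h = 0" if "poly_over F h" "poly h x = 0" "degree h < degree f" for h
    using min[of h] that unfolding P_def by auto
  have deg0: "degree f > 0"
  proof (rule ccontr)
    assume "\<not> degree f > 0"
    then obtain c where "f = [:c:]" using degree_eq_zeroE[of f] by auto
    then show False using fF fx by simp
  qed
  define h where "h = monom 1 ?p - monom (x ^ ?p) 0"
  txt \<open>A minimal \<open>f\<close> divides \<open>h = (X - x)\<^sup>p\<close>, so it is a power of \<open>X - x\<close> up to a unit; its derivative
    shows that this power is the first one.\<close>
  have hpow: "h = [:-x, 1:] ^ ?p"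
  proof -
    have pp: "prime CHAR('a poly)" using prime by simp
    have "[:-x, 1:] = monom 1 1 + monom (- x) 0" by (simp add: monom_altdef)
    then have "[:-x, 1:] ^ ?p = monom 1 1 ^ ?p + monom (- x) 0 ^ ?p"
      using freshmans_dream[OF pp, of ?p "monom 1 1" "monom (-x) 0"] by simp
    also have "\<dots> = monom 1 ?p + monom ((- x) ^ ?p) 0" by (simp add: monom_power)
    also have "(- x) ^ ?p = - (x ^ ?p)"
    proof -
      have "(x + (- x)) ^ ?p = x ^ ?p + (- x) ^ ?p" using freshmans_dream[OF prime] by blast
      then show ?thesis using p by (simp add: eq_neg_iff_add_eq_0 add.commute power_0_left)
    qed
    finally show ?thesis by (simp add: h_def minus_monom)
  qed
  have "poly_over F h"
    unfolding h_def using x subfieldD(2)[OF F]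
    by (intro poly_over_arith[OF F] poly_over_monom[OF F]) auto
  then obtain q r where qr: "h = f * q + r" "poly_over F r" "r = 0 \<or> degree r < degree f"
    using poly_over_division[OF F fF] by blast
  have "poly r x = 0" using arg_cong[OF qr(1), of "\<lambda>p. poly p x"] fx p unfolding hpow by (simp add: power_0_left)
  then have "r = 0" using minD qr by blast
  then have hq: "[:-x, 1:] ^ ?p = f * q" using qr hpow by simp
  have q0: "q \<noteq> 0" using hq by auto
  have "degree ([:-x, 1:] ^ ?p) = ?p" by (simp add: degree_power_eq)
  then have degs: "degree f + degree q = ?p"
    using hq fF q0 by (simp add: degree_mult_eq)
  have "?p = order x ([:-x, 1:] ^ ?p)" by (simp add: order_power_n_n)
  also have "\<dots> = order x f + order x q"
    unfolding hq using fF q0 by (intro order_mult) simp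
  also have "\<dots> \<le> order x f + degree q" using order_degree[OF q0] by simp
  finally have "degree f \<le> order x f" using degs by simp
  have "degree f = 1"
  proof (rule ccontr)
    assume "degree f \<noteq> 1"
    then have "2 \<le> order x f" using deg0 \<open>degree f \<le> order x f\<close> by simp
    then have "[:-x, 1:] ^ 2 dvd f" by (meson order_1 dvd_trans le_imp_power_dvd)
    then obtain u where u: "f = [:-x, 1:] ^ 2 * u" by blast
    define l where "l = [:-x, 1:]"
    have "f = l ^ 2 * u" using u unfolding l_def .
    then have "f = l * (l * u)" by (simp only: power2_eq_square mult.assoc)
    moreover have "poly l x = 0" by (simp add: l_def)
    ultimately have "poly (pderiv f) x = 0" by (simp add: pderiv_mult)
    moreover have "degree (pderiv f) < degree f"
      using deg0 by (intro degree_lessI) (auto simp: coeff_pderiv coeff_eq_0)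
    ultimately have "pderiv f = 0" using minD poly_over_pderiv[OF F] fF by blast
    then have "coeff (pderiv f) (degree f - 1) = 0" by simp
    then have "(of_nat (degree f) :: 'a) = 0" using deg0 fF by (simp add: coeff_pderiv)
    then have "?p dvd degree f" by (simp add: of_nat_eq_0_iff_char_dvd)
    then show False using degf deg0 by (simp add: nat_dvd_not_less)
  qed
  obtain a f' where f': "f = pCons a f'" by (cases f) auto
  then have "degree (pCons a f') = 1" using \<open>degree f = 1\<close> by simp
  then have f'0: "f' \<noteq> 0" "degree f' = 0" by (simp_all add: degree_pCons_eq_if split: if_splits)
  obtain b where "f' = [:b:]" using degree_eq_zeroE[OF f'0(2)] .
  then have "f' = [:b:]" "b \<noteq> 0" using f'0(1) by simp_all
  then have ab: "f = [:a, b:]" "b \<noteq> 0" using f' by auto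
  have "a = coeff f 0" "b = coeff f 1" using ab by auto
  then have "a \<in> F" "b \<in> F" using fF by (auto simp: poly_over_def)
  moreover have "x = - a / b" using fx ab by (simp add: field_simps add_eq_0_iff)
  ultimately have "x = - a / b" "a \<in> F" "b \<in> F" by auto
  then have "x \<in> F" using subfieldD(7,8)[OF F] by auto
  then show False using x by simp
qed

section \<open>Spans over a subfield\<close>

lemma span_overE:
  assumes "y \<in> span_over F B"
  obtains c where "\<forall>x\<in>B. c x \<in> F" "y = (\<Sum>x\<in>B. c x * x)"
  using assms unfolding span_over_def by auto

lemma span_over_add:
  assumes "subfield F" "x \<in> span_over F B" "y \<in> span_over F B"
  shows "x + y \<in> span_over F B"
proof -
  obtain c d where "\<forall>x\<in>B. c x \<in> F" "x = (\<Sum>x\<in>B. c x * x)" "\<forall>x\<in>B. d x \<in> F" "y = (\<Sum>x\<in>B. d x * x)"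
    using assms unfolding span_over_def by auto
  then have "\<forall>x\<in>B. c x + d x \<in> F" "x + y = (\<Sum>x\<in>B. (c x + d x) * x)"
    using subfieldD(3)[OF assms(1)] by (auto simp: sum.distrib algebra_simps)
  then show ?thesis unfolding span_over_def by (intro CollectI exI[of _ "\<lambda>x. c x + d x"]) simp
qed

lemma span_over_scale:
  assumes "subfield F" "a \<in> F" "x \<in> span_over F B"
  shows "a * x \<in> span_over F B"
proof -
  obtain c where "\<forall>x\<in>B. c x \<in> F" "x = (\<Sum>x\<in>B. c x * x)"
    using assms unfolding span_over_def by auto
  then have "\<forall>x\<in>B. a * c x \<in> F" "a * x = (\<Sum>x\<in>B. (a * c x) * x)"
    using subfieldD(5)[OF assms(1)] assms(2) by (auto simp: sum_distrib_left algebra_simps)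
  then show ?thesis unfolding span_over_def by (intro CollectI exI[of _ "\<lambda>x. a * c x"]) simp
qed

lemma span_over_zero: "subfield F \<Longrightarrow> 0 \<in> span_over F B"
  unfolding span_over_def by (intro CollectI exI[of _ "\<lambda>_. 0"]) (simp add: subfieldD)

lemma span_over_base: "subfield F \<Longrightarrow> finite B \<Longrightarrow> b \<in> B \<Longrightarrow> b \<in> span_over F B"
  unfolding span_over_def
  by (intro CollectI exI[of _ "\<lambda>x. if x = b then 1 else 0"]) (simp add: subfieldD if_distrib[of "\<lambda>c. c * _"] cong: if_cong)

lemma span_over_sum:
  assumes "subfield F" "\<And>i. i \<in> I \<Longrightarrow> f i \<in> span_over F B"
  shows "sum f I \<in> span_over F B"
  using assms(2)
  by (induction I rule: infinite_finite_induct) (auto simp: span_over_zero[OF assms(1)] intro: span_over_add[OF assms(1)])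

lemma span_over_mono: "F \<subseteq> F' \<Longrightarrow> span_over F B \<subseteq> span_over F' B"
  unfolding span_over_def by blast

lemma span_over_least:
  assumes "subfield L" "F \<subseteq> L" "B \<subseteq> L" shows "span_over F B \<subseteq> L"
  unfolding span_over_def using assms by (auto intro!: subfield_sum[OF assms(1)] subfieldD(5)[OF assms(1)])

section \<open>Powers and roots under Frobenius\<close>

lemma CHAR_power_add:
  fixes x y :: "'a::field"
  assumes "CHAR('a) > 0"
  shows "(x + y) ^ (CHAR('a) ^ n) = x ^ (CHAR('a) ^ n) + y ^ (CHAR('a) ^ n)"
  using freshmans_dream'[OF prime_CHAR_semidom[OF assms] refl] .

lemma CHAR_power_diff:
  fixes x y :: "'a::field"
  assumes "CHAR('a) > 0"
  shows "(x - y) ^ (CHAR('a) ^ n) = x ^ (CHAR('a) ^ n) - y ^ (CHAR('a) ^ n)"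
  using CHAR_power_add[OF assms, of "x - y" y n] by simp

lemma CHAR_power_sum:
  fixes f :: "'b \<Rightarrow> 'a::field"
  assumes "CHAR('a) > 0"
  shows "sum f A ^ (CHAR('a) ^ n) = (\<Sum>i\<in>A. f i ^ (CHAR('a) ^ n))"
  using freshmans_dream_sum'[OF prime_CHAR_semidom[OF assms] refl] .

lemma CHAR_power_inj:
  fixes x y :: "'a::field"
  assumes "CHAR('a) > 0" "x ^ (CHAR('a) ^ n) = y ^ (CHAR('a) ^ n)"
  shows "x = y"
  using CHAR_power_diff[OF assms(1), of x y n] assms by simp

lemma subfield_proot:
  fixes F :: "'a::field set"
  assumes "CHAR('a) > 0" "subfield F" shows "subfield (proot F n)"
  unfolding subfield_def proot_def
  by (auto simp: CHAR_power_add[OF assms(1)] CHAR_power_diff[OF assms(1)] power_mult_distrib power_inverse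
      subfieldD[OF assms(2)] power_0_left assms(1))

lemma subfield_ppow:
  fixes F :: "'a::field set"
  assumes "CHAR('a) > 0" "subfield F" shows "subfield (ppow F n)"
proof -
  let ?q = "CHAR('a) ^ n"
  have "0 ^ ?q \<in> ppow F n" "1 ^ ?q \<in> ppow F n"
    unfolding ppow_def using subfieldD(1,2)[OF assms(2)] by blast+
  moreover have "x + y \<in> ppow F n \<and> x - y \<in> ppow F n \<and> x * y \<in> ppow F n"
    if xy: "x \<in> ppow F n" "y \<in> ppow F n" for x y
  proof -
    obtain u v where "u \<in> F" "v \<in> F" and eq: "x = u ^ ?q" "y = v ^ ?q" using xy by (auto simp: ppow_def)
    then have "(u + v) ^ ?q \<in> ppow F n" "(u - v) ^ ?q \<in> ppow F n" "(u * v) ^ ?q \<in> ppow F n"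
      unfolding ppow_def using subfieldD(3-5)[OF assms(2)] by blast+
    then show ?thesis
      unfolding eq by (simp add: CHAR_power_add[OF assms(1)] CHAR_power_diff[OF assms(1)] power_mult_distrib)
  qed
  moreover have "inverse x \<in> ppow F n" if "x \<in> ppow F n" for x
    using that subfieldD(6)[OF assms(2)] by (auto simp: ppow_def simp flip: power_inverse)
  ultimately show ?thesis
    unfolding subfield_def using assms(1) by (simp add: power_0_left)
qed

lemma ppow_subset_iff: "ppow A n \<subseteq> B \<longleftrightarrow> A \<subseteq> proot B n"
  by (auto simp: ppow_def proot_def)

lemma ppow_mono: "A \<subseteq> B \<Longrightarrow> ppow A n \<subseteq> ppow B n"
  by (auto simp: ppow_def)

lemma ppow_0 [simp]: "ppow A 0 = A"
  by (simp add: ppow_def)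

lemma ppow_ppow: "ppow (ppow A m) n = ppow A (m + n)"
  by (auto simp: ppow_def image_image power_add simp flip: power_mult)

lemma ppow_subset: "subfield F \<Longrightarrow> ppow F n \<subseteq> F"
  by (auto simp: ppow_def intro: subfieldD)

lemma ppow_gen_subset:
  fixes M :: "'a::field set"
  assumes "CHAR('a) > 0" "subfield M" "ppow k n \<subseteq> M" "ppow G n \<subseteq> M"
  shows "ppow (gen k G) n \<subseteq> M"
  using assms unfolding ppow_subset_iff by (intro gen_least subfield_proot)

lemma gen_ppow_gen:
  fixes k :: "'a::field set"
  assumes "CHAR('a) > 0" "subfield k"
  shows "gen k (ppow (gen k G) n) = gen k (ppow G n)"
proof (rule antisym)
  have "ppow k n \<subseteq> gen k (ppow G n)"
    using ppow_subset[OF assms(2), of n] gen_base[of k "ppow G n"] by blast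
  then show "gen k (ppow (gen k G) n) \<subseteq> gen k (ppow G n)"
    by (intro gen_least ppow_gen_subset[OF assms(1)]) (auto intro: gen_base[THEN subsetD] gen_superset[THEN subsetD])
  show "gen k (ppow G n) \<subseteq> gen k (ppow (gen k G) n)"
    by (intro gen_mono ppow_mono gen_superset order_refl)
qed

lemma proot_mono: "subfield F \<Longrightarrow> m \<le> n \<Longrightarrow> proot F m \<subseteq> proot F n"
  unfolding proot_def using subfieldD(9)[of F]
  by (auto simp: power_mult dest!: le_Suc_ex simp: power_add)

text \<open>The perfect closure of \<open>k\<close> in the ambient field. It is itself a field, so
  pure inseparability of a generated field need only be checked on generators.\<close>

definition pi_elems :: "'a::field set \<Rightarrow> 'a set" where
  "pi_elems k = {x. \<exists>n. x ^ (CHAR('a) ^ n) \<in> k}"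

lemma pi_elems_eq: "pi_elems k = (\<Union>n. proot k n)"
  by (auto simp: pi_elems_def proot_def)

lemma subfield_chain_Union:
  fixes F :: "nat \<Rightarrow> 'a::field set"
  assumes "\<And>n. subfield (F n)" "\<And>m n. m \<le> n \<Longrightarrow> F m \<subseteq> F n"
  shows "subfield (\<Union>n. F n)"
proof -
  have 2: "\<exists>n. x \<in> F n \<and> y \<in> F n" if "x \<in> (\<Union>n. F n)" "y \<in> (\<Union>n. F n)" for x y
    using that assms(2) by (metis UN_E max.cobounded1 max.cobounded2 subsetD)
  show ?thesis
  proof (rule subfieldI)
    fix x y assume "x \<in> (\<Union>n. F n)" "y \<in> (\<Union>n. F n)"
    then obtain n where n: "x \<in> F n" "y \<in> F n" using 2 by blast
    show "x + y \<in> (\<Union>n. F n)" "x - y \<in> (\<Union>n. F n)" "x * y \<in> (\<Union>n. F n)"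
      using subfieldD(3-5)[OF assms(1), OF n] by auto
  next
    fix x assume "x \<in> (\<Union>n. F n)"
    then obtain n where "x \<in> F n" by blast
    then show "inverse x \<in> (\<Union>n. F n)" using subfieldD(6)[OF assms(1)] by blast
  qed (use subfieldD(1,2)[OF assms(1)] in auto)
qed

lemma subfield_pi_elems:
  fixes k :: "'a::field set"
  assumes "CHAR('a) > 0" "subfield k" shows "subfield (pi_elems k)"
  unfolding pi_elems_eq using assms by (intro subfield_chain_Union subfield_proot proot_mono)

lemma purely_inseparable_iff: "purely_inseparable k K \<longleftrightarrow> K \<subseteq> pi_elems k"
  by (auto simp: purely_inseparable_def pi_elems_def)

lemma subset_pi_elems: "k \<subseteq> pi_elems k"
  by (auto simp: pi_elems_def intro!: exI[of _ 0])

text \<open>A span closed under products is already a field here: if q = p^n and x^q lies in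
  \<open>F\<close>, then 1/x is the \<open>F\<close>-multiple of x^(q-1) by the inverse of
  x^q.\<close>

lemma gen_eq_span_over:
  fixes F :: "'a::field set"
  assumes p: "CHAR('a) > 0" and F: "subfield F" and B: "finite B" "B \<subseteq> pi_elems F"
    and one: "1 \<in> span_over F B" and mult: "\<And>b c. b \<in> B \<Longrightarrow> c \<in> B \<Longrightarrow> b * c \<in> span_over F B"
  shows "gen F B = span_over F B"
proof (rule gen_eqI)
  let ?V = "span_over F B"
  have FV: "a \<in> ?V" if "a \<in> F" for a using span_over_scale[OF F that one] by simp
  have V1: "b * y \<in> ?V" if bV: "b \<in> B" "y \<in> ?V" for b y
  proof -
    obtain c where c: "\<forall>x\<in>B. c x \<in> F" "y = (\<Sum>x\<in>B. c x * x)" by (rule span_overE[OF bV(2)])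
    have eq: "b * y = (\<Sum>x\<in>B. c x * (b * x))" unfolding c(2) by (simp add: sum_distrib_left algebra_simps)
    show ?thesis unfolding eq
      by (rule span_over_sum[OF F], rule span_over_scale[OF F]) (use c(1) bV mult in auto)
  qed
  have V2: "x * y \<in> ?V" if xy: "x \<in> ?V" "y \<in> ?V" for x y
  proof -
    obtain c where c: "\<forall>x\<in>B. c x \<in> F" "x = (\<Sum>x\<in>B. c x * x)" by (rule span_overE[OF xy(1)])
    have eq: "x * y = (\<Sum>x\<in>B. c x * (x * y))" unfolding c(2) by (simp add: sum_distrib_left sum_distrib_right algebra_simps)
    show ?thesis unfolding eq
      by (rule span_over_sum[OF F], rule span_over_scale[OF F]) (use c(1) xy V1 in auto)
  qed
  have pow: "x ^ n \<in> ?V" if "x \<in> ?V" for x n by (induction n) (use one V2 that in auto)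
  have "?V \<subseteq> pi_elems F"
    by (rule span_over_least[OF subfield_pi_elems[OF p F] subset_pi_elems B(2)])
  then have inv: "inverse x \<in> ?V" if x: "x \<in> ?V" for x
  proof -
    obtain n where n: "x ^ (CHAR('a) ^ n) \<in> F" using x \<open>?V \<subseteq> pi_elems F\<close> by (auto simp: pi_elems_def)
    obtain m where m: "CHAR('a) ^ n = Suc m" using p by (metis gr0_implies_Suc zero_less_power)
    have eq: "inverse x = inverse (x ^ Suc m) * x ^ m" by (cases "x = 0") (auto simp: field_simps)
    have "inverse (x ^ Suc m) * x ^ m \<in> ?V"
      using span_over_scale[OF F subfieldD(6)[OF F n] pow[OF x, of m]] unfolding m .
    then show ?thesis by (subst eq)
  qed
  have neg: "x - y \<in> ?V" if "x \<in> ?V" "y \<in> ?V" for x y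
    using span_over_add[OF F that(1) span_over_scale[OF F subfieldD(7)[OF F subfieldD(2)[OF F]] that(2)]] by simp
  show "subfield ?V"
    using span_over_zero[OF F] one span_over_add[OF F] neg V2 inv by (rule subfieldI)
  show "F \<subseteq> ?V" using FV by (rule subsetI)
  show "B \<subseteq> ?V" using span_over_base[OF F B(1)] by (rule subsetI)
  show "?V \<subseteq> gen F B" by (rule span_over_least[OF subfield_gen gen_base gen_superset])
qed

section \<open>Degrees\<close>

definition findim :: "'a::field set \<Rightarrow> 'a set \<Rightarrow> bool" where
  "findim F L \<longleftrightarrow> (\<exists>n. vdim n F L)"

definition deg :: "'a::field set \<Rightarrow> 'a set \<Rightarrow> nat" where
  "deg F L = (THE n. vdim n F L)"

lemma deg_eqI: "subfield F \<Longrightarrow> vdim n F L \<Longrightarrow> deg F L = n"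
  unfolding deg_def by (rule the_equality) (auto intro: vdim_unique)

lemma findim_vdim: "subfield F \<Longrightarrow> findim F L \<Longrightarrow> vdim (deg F L) F L"
  unfolding findim_def using deg_eqI by blast

lemma vdimE:
  assumes "vdim n F V"
  obtains B where "finite B" "card B = n" "lin_indep_over F B" "V = span_over F B"
  using assms unfolding vdim_def by (elim exE conjE)

lemma vdimI: "finite B \<Longrightarrow> card B = n \<Longrightarrow> lin_indep_over F B \<Longrightarrow> V = span_over F B \<Longrightarrow> vdim n F V"
  unfolding vdim_def by (intro exI[of _ B]) simp

lemma span_over_subset: "subfield F \<Longrightarrow> finite B \<Longrightarrow> B \<subseteq> span_over F B"
  using span_over_base by blast

lemma findim_intermediate:
  assumes F: "subfield F" and M: "subfield M" and L: "subfield L" and sub: "F \<subseteq> M" "M \<subseteq> L"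
    and fin: "findim F L"
  shows "findim F M" "findim M L"
proof -
  obtain n where n: "vdim n F L" using fin unfolding findim_def ..
  obtain m where "vdim m F M"
    by (rule vdim_subspace[OF F n sub(2)]) (use sub subfieldD[OF M] in auto)
  then show "findim F M" unfolding findim_def ..
  obtain B where B: "finite B" "L = span_over F B" using vdimE[OF n] by metis
  have "B \<subseteq> L" using span_over_subset[OF F B(1)] B(2) by simp
  then have "span_over M B = L"
    using span_over_least[OF L sub(2)] span_over_mono[OF sub(1), of B] B(2) by blast
  then show "findim M L"
    using vdim_span_over[OF M B(1)] unfolding findim_def by metis
qed

lemma findim_trans:
  assumes "subfield F" "subfield M" "findim F M" "findim M L"
  shows "findim F L" "deg F L = deg F M * deg M L"
proof -
  have "vdim (deg F M * deg M L) F L"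
    by (intro vdim_tower[OF assms(1,2)] findim_vdim assms)
  then show "findim F L" "deg F L = deg F M * deg M L"
    using deg_eqI[OF assms(1)] unfolding findim_def by blast+
qed

lemma deg_tower:
  assumes "subfield F" "subfield M" "subfield L" "F \<subseteq> M" "M \<subseteq> L" "findim F L"
  shows "deg F L = deg F M * deg M L"
  by (rule findim_trans(2)[OF assms(1,2) findim_intermediate[OF assms]])

lemma vdim_self:
  assumes F: "subfield F" shows "vdim 1 F F"
proof (rule vdimI[of "{1}"])
  show "lin_indep_over F {1}" by (rule lin_indep_over_finiteI[OF F]) auto
  show "F = span_over F {1}"
    unfolding span_over_def by (auto intro!: exI[of _ "\<lambda>_. _"])
qed auto

lemma deg_self: "subfield F \<Longrightarrow> deg F F = 1" and findim_self: "subfield F \<Longrightarrow> findim F F"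
  using vdim_self deg_eqI unfolding findim_def by blast+

lemma deg_pos:
  assumes "subfield F" "subfield L" "findim F L" shows "deg F L > 0"
proof (rule ccontr)
  assume "\<not> deg F L > 0"
  then have "vdim 0 F L" using findim_vdim[OF assms(1,3)] by simp
  then obtain B where "finite B" "card B = 0" "L = span_over F B" using vdimE by metis
  then have "L = {0}" unfolding span_over_def by auto
  then show False using subfieldD(2)[OF assms(2)] by auto
qed

lemma eq_if_deg_eq_1:
  assumes "subfield F" "subfield L" "F \<subseteq> L" "findim F L" "deg F L = 1" shows "L = F"
proof -
  have "lin_indep_over F {1}" by (rule lin_indep_over_finiteI[OF assms(1)]) auto
  moreover have "{1} \<subseteq> L" using subfieldD(2)[OF assms(2)] by simp
  ultimately obtain B where B: "{1} \<subseteq> B" "finite B" "card B = 1" "L = span_over F B"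
    using vdim_extend_basis[OF assms(1) findim_vdim[OF assms(1,4)]] assms(5) by metis
  then have "B = {1}" by (metis card_1_singletonE insert_subset singletonD)
  then show ?thesis using B(4) span_over_least[OF assms(1) order_refl, of B] subfieldD(2)[OF assms(1)] assms(3) by auto
qed

text \<open>Products of elements of \<open>B\<close> stay in the \<open>F\<close>-span of
  \<open>B\<close>, so enlarging the scalars to \<open>F'\<close> gives a span closed under
  multiplication. A basis thus keeps spanning the compositum, and only its independence can be
  lost.\<close>

lemma gen_compositum_span_over:
  fixes F :: "'a::field set"
  assumes p: "CHAR('a) > 0" and F: "subfield F" "subfield F'" "subfield L" and sub: "F \<subseteq> F'"
    and B: "finite B" "L = span_over F B" and pi: "L \<subseteq> pi_elems F'"
  shows "gen F' L = span_over F' B"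
proof -
  have BL: "B \<subseteq> L" using span_over_subset[OF F(1) B(1)] B(2) by simp
  have L: "L \<subseteq> span_over F' B" using span_over_mono[OF sub] B(2) by blast
  have eq: "gen F' B = span_over F' B"
  proof (rule gen_eq_span_over[OF p F(2) B(1)])
    show "1 \<in> span_over F' B" using L subfieldD(2)[OF F(3)] by blast
    show "b * c \<in> span_over F' B" if "b \<in> B" "c \<in> B" for b c
      using L BL subfieldD(5)[OF F(3)] that by blast
  qed (use BL pi in blast)
  moreover have "gen F' L = gen F' B"
  proof (rule antisym)
    show "gen F' L \<subseteq> gen F' B" using L eq by (intro gen_least subfield_gen gen_base) simp
    show "gen F' B \<subseteq> gen F' L" using BL by (intro gen_mono) auto
  qed
  ultimately show ?thesis by simp
qed

lemma deg_compositum_le: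
  fixes F :: "'a::field set"
  assumes p: "CHAR('a) > 0" and F: "subfield F" "subfield F'" "subfield L" and sub: "F \<subseteq> F'"
    and fin: "findim F L" and pi: "L \<subseteq> pi_elems F'"
  shows "findim F' (gen F' L)" "deg F' (gen F' L) \<le> deg F L"
proof -
  obtain B where B: "finite B" "card B = deg F L" "L = span_over F B"
    using vdimE[OF findim_vdim[OF F(1) fin]] by metis
  obtain n where n: "vdim n F' (span_over F' B)" "n < card B \<or> n = card B \<and> lin_indep_over F' B"
    by (rule vdim_span_over[OF F(2) B(1)])
  note eq = gen_compositum_span_over[OF p F sub B(1,3) pi]
  show "findim F' (gen F' L)" unfolding eq findim_def using n(1) ..
  show "deg F' (gen F' L) \<le> deg F L" unfolding eq using deg_eqI[OF F(2) n(1)] n(2) B(2) by auto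
qed

text \<open>Frobenius is an injective ring homomorphism, so it carries a basis of \<open>V\<close>
  over \<open>F\<close> to a basis of the images; coefficients are transported along with the
  vectors.\<close>

lemma vdim_ppow:
  fixes F :: "'a::field set"
  assumes p: "CHAR('a) > 0" and F: "subfield F" and V: "vdim n F V"
  shows "vdim n (ppow F m) (ppow V m)"
proof -
  let ?f = "\<lambda>x::'a. x ^ (CHAR('a) ^ m)"
  obtain B where B: "finite B" "card B = n" "lin_indep_over F B" "V = span_over F B" using vdimE[OF V] .
  have inj: "inj ?f" using CHAR_power_inj[OF p] by (auto intro!: injI)
  then have injB: "inj_on ?f B" using inj_on_subset by blast
  have sums: "(\<Sum>x\<in>?f ` B. c x * x) = (\<Sum>x\<in>B. d x * x) ^ (CHAR('a) ^ m)"
    if "\<And>x. x \<in> B \<Longrightarrow> c (?f x) = ?f (d x)" for c d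
    unfolding CHAR_power_sum[OF p] sum.reindex[OF injB] using that by (auto simp: power_mult_distrib intro!: sum.cong)
  show ?thesis
  proof (rule vdimI[of "?f ` B"])
    show "finite (?f ` B)" using B by simp
    show "card (?f ` B) = n" using card_image[OF injB] B by simp
    show "lin_indep_over (ppow F m) (?f ` B)"
    proof (rule lin_indep_over_finiteI[OF subfield_ppow[OF p F]])
      fix c y assume c: "\<And>x. x \<in> ?f ` B \<Longrightarrow> c x \<in> ppow F m" "(\<Sum>x\<in>?f ` B. c x * x) = 0" "y \<in> ?f ` B"
      have "\<forall>x\<in>B. \<exists>d\<in>F. c (?f x) = ?f d" using c(1) unfolding ppow_def by blast
      then obtain d where d: "\<And>x. x \<in> B \<Longrightarrow> d x \<in> F" "\<And>x. x \<in> B \<Longrightarrow> c (?f x) = ?f (d x)" by metis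
      have "(\<Sum>x\<in>B. d x * x) = 0" using sums[of c d] d(2) c(2) p by simp
      then have "d x = 0" if "x \<in> B" for x using lin_indep_overD[OF B(3) order_refl B(1), of d] d(1) that by blast
      then show "c y = 0" using c(3) d(2) p by (auto simp: power_0_left)
    qed (use B in simp)
    show "ppow V m = span_over (ppow F m) (?f ` B)"
    proof (intro equalityI subsetI)
      fix y assume "y \<in> ppow V m"
      then obtain v where v: "v \<in> V" "y = ?f v" unfolding ppow_def by blast
      obtain d where d: "\<forall>x\<in>B. d x \<in> F" "v = (\<Sum>x\<in>B. d x * x)"
        using v(1) unfolding B(4) by (rule span_overE)
      define c where "c y = ?f (d (inv_into UNIV ?f y))" for y
      have c: "c (?f x) = ?f (d x)" for x unfolding c_def using inv_f_f[OF inj] by simp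
      have "y = (\<Sum>x\<in>?f ` B. c x * x)" using sums[of c d] c v d(2) by simp
      moreover have "\<forall>x\<in>?f ` B. c x \<in> ppow F m" using c d(1) by (auto simp: ppow_def)
      ultimately show "y \<in> span_over (ppow F m) (?f ` B)" unfolding span_over_def by blast
    next
      fix y assume "y \<in> span_over (ppow F m) (?f ` B)"
      then obtain c where c: "\<forall>x\<in>?f ` B. c x \<in> ppow F m" "y = (\<Sum>x\<in>?f ` B. c x * x)" by (rule span_overE)
      have "\<forall>x\<in>B. \<exists>d\<in>F. c (?f x) = ?f d" using c(1) unfolding ppow_def by blast
      then obtain d where d: "\<And>x. x \<in> B \<Longrightarrow> d x \<in> F" "\<And>x. x \<in> B \<Longrightarrow> c (?f x) = ?f (d x)" by metis
      have "y = ?f (\<Sum>x\<in>B. d x * x)" using sums[of c d] d(2) c(2) by simp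
      moreover have "(\<Sum>x\<in>B. d x * x) \<in> V" using d(1) B(4) unfolding span_over_def by blast
      ultimately show "y \<in> ppow V m" unfolding ppow_def by blast
    qed
  qed
qed

lemma deg_ppow:
  fixes F :: "'a::field set"
  assumes "CHAR('a) > 0" "subfield F" "findim F L"
  shows "findim (ppow F m) (ppow L m)" "deg (ppow F m) (ppow L m) = deg F L"
  using vdim_ppow[OF assms(1,2) findim_vdim[OF assms(2,3)]] deg_eqI[OF subfield_ppow[OF assms(1,2)]]
  unfolding findim_def by blast+

text \<open>The basis is 1, x, ..., x^(p-1). Independence is \<open>poly_nonzero_below_CHAR\<close>;
  a product with exponent p or more is reduced by moving x^p into the scalars.\<close>

lemma vdim_simple_extension:
  fixes F :: "'a::field set"
  assumes p: "CHAR('a) > 0" and F: "subfield F" and x: "x ^ CHAR('a) \<in> F" "x \<notin> F"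
  shows "vdim CHAR('a) F (gen F {x})"
proof -
  let ?p = "CHAR('a)" let ?B = "(\<lambda>i. x ^ i) ` {..<?p}"
  note nz = poly_nonzero_below_CHAR[OF p F x]
  have neq: "x ^ i \<noteq> x ^ j" if "i < j" "j < ?p" for i j
  proof -
    have "coeff (monom 1 j - monom (1::'a) i) j \<noteq> 0" using that by simp
    then have "monom 1 j - monom (1::'a) i \<noteq> 0" by (metis coeff_0)
    moreover have "degree (monom 1 j - monom (1::'a) i) < ?p"
      using that by (intro degree_diff_less) (auto simp: degree_monom_eq)
    ultimately have "poly (monom 1 j - monom (1::'a) i) x \<noteq> 0"
      by (intro nz poly_over_arith[OF F] poly_over_monom[OF F] subfieldD(2)[OF F])
    then show ?thesis by (simp add: poly_monom)
  qed
  have inj: "inj_on (\<lambda>i. x ^ i) {..<?p}"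
    by (rule inj_onI) (metis neq lessThan_iff linorder_neqE_nat)
  have li: "lin_indep_over F ?B"
  proof (rule lin_indep_over_finiteI[OF F])
    fix c y assume c: "\<And>x. x \<in> ?B \<Longrightarrow> c x \<in> F" "(\<Sum>x\<in>?B. c x * x) = 0" "y \<in> ?B"
    define g where "g = (\<Sum>i<?p. monom (c (x ^ i)) i)"
    have cg: "coeff g i = (if i < ?p then c (x ^ i) else 0)" for i
      unfolding g_def coeff_sum by (simp add: if_distrib cong: if_cong)
    have pg: "poly g x = (\<Sum>x\<in>?B. c x * x)"
      unfolding g_def sum.reindex[OF inj] by (simp add: poly_sum poly_monom)
    have Fg: "poly_over F g" unfolding poly_over_def cg using c(1) subfieldD(1)[OF F] by auto
    have "coeff g k = 0" if "?p \<le> k" for k using cg[of k] that by simp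
    then have dg: "degree g < ?p" by (rule degree_lessI[OF disjI2[OF p], rule_format])
    have "g = 0"
    proof (rule ccontr)
      assume "g \<noteq> 0"
      from nz[OF Fg this dg] show False using pg c(2) by simp
    qed
    obtain i where "i < ?p" "y = x ^ i" using c(3) by blast
    then show "c y = 0" using cg[of i] \<open>g = 0\<close> by simp
  qed simp
  have xp: "x \<in> pi_elems F" unfolding pi_elems_def using x by (auto intro!: exI[of _ 1])
  have "gen F ?B = span_over F ?B"
  proof (rule gen_eq_span_over[OF p F])
    show "?B \<subseteq> pi_elems F" using subfieldD(9)[OF subfield_pi_elems[OF p F] xp] by blast
    have "x ^ 0 \<in> ?B" using p by blast
    then show "1 \<in> span_over F ?B" using span_over_subset[OF F, of ?B] by auto
    fix b c assume "b \<in> ?B" "c \<in> ?B"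
    then obtain i j where ij: "i < ?p" "j < ?p" "b = x ^ i" "c = x ^ j" by blast
    show "b * c \<in> span_over F ?B"
    proof (cases "i + j < ?p")
      case True
      then have "b * c \<in> ?B" using ij by (auto simp flip: power_add)
      then show ?thesis using span_over_subset[OF F, of ?B] by blast
    next
      case False
      then have "b * c = x ^ ?p * x ^ (i + j - ?p)" using ij by (simp flip: power_add)
      moreover have "x ^ (i + j - ?p) \<in> ?B" using ij False by (intro imageI) auto
      ultimately show ?thesis using span_over_subset[OF F, of ?B] span_over_scale[OF F x(1)] by auto
    qed
  qed simp
  moreover have "gen F ?B = gen F {x}"
  proof (rule antisym)
    show "gen F ?B \<subseteq> gen F {x}"
      using gen_superset[of "{x}" F] by (intro gen_least subfield_gen gen_base) (auto intro!: subfieldD(9))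
    have "1 < ?p" using prime_CHAR_semidom[OF p] prime_gt_1_nat by blast
    then have "x ^ 1 \<in> ?B" by blast
    then show "gen F {x} \<subseteq> gen F ?B" by (intro gen_mono) auto
  qed
  ultimately show ?thesis
    using li card_image[OF inj] by (intro vdimI[of ?B]) auto
qed

section \<open>Rank of a finite purely inseparable extension\<close>

lemma gen_empty: "subfield k \<Longrightarrow> gen k {} = k"
  by (rule gen_absorb) simp_all

lemma gen_insert: "gen k (insert x G) = gen (gen k G) {x}"
  unfolding gen_gen by simp

text \<open>Greedy selection: a p-th root of an element of \<open>M\<close> either lies in the field
  reached so far or multiplies the degree by p. In exponent one, generating sets therefore behave
  like spanning sets of a vector space.\<close>

lemma p_generating_subset:
  fixes M :: "'a::field set"
  assumes p: "CHAR('a) > 0" and M: "subfield M" and G: "finite G" "\<And>x. x \<in> G \<Longrightarrow> x ^ CHAR('a) \<in> M"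
  shows "\<exists>G'\<subseteq>G. gen M G' = gen M G \<and> vdim (CHAR('a) ^ card G') M (gen M G')"
  using G
proof (induction G rule: finite_induct)
  case empty
  show ?case using vdim_self[OF M] by (simp add: gen_empty[OF M])
next
  case (insert x G)
  then obtain G' where G': "G' \<subseteq> G" "gen M G' = gen M G" "vdim (CHAR('a) ^ card G') M (gen M G')"
    by auto
  let ?N = "gen M G'"
  have eq: "gen M (insert x G) = gen ?N {x}" using gen_insert[of M x G] G'(2) by simp
  show ?case
  proof (cases "x \<in> ?N")
    case True
    then have "gen ?N {x} = ?N" by (intro gen_absorb) auto
    then show ?thesis using G' eq by (intro exI[of _ G']) auto
  next
    case False
    have fin: "finite G'" using G'(1) insert(1) finite_subset by blast
    have "x \<notin> G'" using False gen_superset[of G' M] by blast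
    have "x ^ CHAR('a) \<in> ?N" using insert.prems[of x] gen_base[of M G'] by auto
    then have "vdim CHAR('a) ?N (gen ?N {x})"
      using False by (intro vdim_simple_extension[OF p]) auto
    then have "vdim (CHAR('a) ^ card G' * CHAR('a)) M (gen ?N {x})"
      by (rule vdim_tower[OF M subfield_gen G'(3)])
    moreover have "CHAR('a) ^ card (insert x G') = CHAR('a) ^ card G' * CHAR('a)"
      using fin \<open>x \<notin> G'\<close> by simp
    ultimately have "vdim (CHAR('a) ^ card (insert x G')) M (gen M (insert x G'))"
      by (simp add: gen_insert[of M x G'])
    then show ?thesis using G'(1) eq by (intro exI[of _ "insert x G'"]) (auto simp: gen_insert[of M x G'])
  qed
qed

text \<open>Greedy selection cannot drop any element of an irredundant set.\<close>

lemma vdim_p_independent: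
  fixes M :: "'a::field set"
  assumes p: "CHAR('a) > 0" and M: "subfield M" and G: "finite G" "\<And>x. x \<in> G \<Longrightarrow> x ^ CHAR('a) \<in> M"
    and ind: "\<And>x. x \<in> G \<Longrightarrow> x \<notin> gen M (G - {x})"
  shows "vdim (CHAR('a) ^ card G) M (gen M G)"
proof -
  obtain G' where G': "G' \<subseteq> G" "gen M G' = gen M G" "vdim (CHAR('a) ^ card G') M (gen M G')"
    using p_generating_subset[OF p M G] by blast
  have "x \<in> G'" if x: "x \<in> G" for x
  proof (rule ccontr)
    assume "x \<notin> G'"
    then have "gen M G' \<subseteq> gen M (G - {x})" using G'(1) by (intro gen_mono) auto
    then show False using ind[OF x] x G'(2) gen_superset[of G M] by blast
  qed
  then have "G' = G" using G'(1) by blast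
  then show ?thesis using G'(3) by simp
qed

lemma pi_elems_mono: "k \<subseteq> k' \<Longrightarrow> pi_elems k \<subseteq> pi_elems k'"
  unfolding pi_elems_def by blast

text \<open>Induction on the exponent through the tower k, k(x^p), k(x), whose top step has degree 1
  or p.\<close>

lemma findim_gen_singleton:
  fixes k :: "'a::field set"
  assumes p: "CHAR('a) > 0" and k: "subfield k" and x: "x ^ (CHAR('a) ^ n) \<in> k"
  shows "findim k (gen k {x})"
  using x
proof (induction n arbitrary: x)
  case 0
  then show ?case using findim_self[OF k] gen_absorb[OF k, of "{x}"] by simp
next
  case (Suc n)
  let ?N = "gen k {x ^ CHAR('a)}"
  have "(x ^ CHAR('a)) ^ (CHAR('a) ^ n) \<in> k" using Suc.prems by (simp flip: power_mult)
  then have N: "findim k ?N" by (rule Suc.IH)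
  have "x ^ CHAR('a) \<in> gen k {x}" using gen_superset[of "{x}" k] by (auto intro: subfieldD(9))
  then have "gen (gen k {x}) {x ^ CHAR('a)} = gen k {x}" by (intro gen_absorb) auto
  then have eq: "gen ?N {x} = gen k {x}" by (simp add: gen_gen insert_commute)
  have xN: "x ^ CHAR('a) \<in> ?N" using gen_superset by auto
  have "findim ?N (gen ?N {x})"
  proof (cases "x \<in> ?N")
    case True
    then show ?thesis using findim_self[of ?N] gen_absorb[of ?N "{x}"] by simp
  next
    case False
    then show ?thesis using vdim_simple_extension[OF p subfield_gen xN] unfolding findim_def by blast
  qed
  then show ?case using findim_trans(1)[OF k subfield_gen N] eq by simp
qed

lemma findim_gen:
  fixes k :: "'a::field set"
  assumes p: "CHAR('a) > 0" and k: "subfield k" and G: "finite G" "G \<subseteq> pi_elems k"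
  shows "findim k (gen k G)"
  using G
proof (induction G rule: finite_induct)
  case empty
  show ?case using findim_self[OF k] by (simp add: gen_empty[OF k])
next
  case (insert x G)
  then obtain n where "x ^ (CHAR('a) ^ n) \<in> k" by (auto simp: pi_elems_def)
  then have "x ^ (CHAR('a) ^ n) \<in> gen k G" using gen_base[of k G] by blast
  then have 1: "findim (gen k G) (gen (gen k G) {x})" by (rule findim_gen_singleton[OF p subfield_gen])
  have 2: "findim k (gen k G)" using insert by auto
  show ?case unfolding gen_insert[of k x G] by (rule findim_trans(1)[OF k subfield_gen 2 1])
qed

section \<open>Finite purely inseparable extensions: exponent, generators and rank\<close>

definition fpi :: "'a::field set \<Rightarrow> 'a set \<Rightarrow> bool" where
  "fpi k L \<longleftrightarrow> subfield k \<and> subfield L \<and> k \<subseteq> L \<and> L \<subseteq> pi_elems k \<and> findim k L"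

lemma fpiD:
  assumes "fpi k L"
  shows "subfield k" "subfield L" "k \<subseteq> L" "L \<subseteq> pi_elems k" "findim k L"
  using assms by (simp_all add: fpi_def)

lemma fpi_gen:
  fixes k :: "'a::field set"
  assumes p: "CHAR('a) > 0" and k: "subfield k" and G: "finite G" "G \<subseteq> pi_elems k"
  shows "fpi k (gen k G)"
  unfolding fpi_def using findim_gen[OF assms] k gen_base gen_least[OF subfield_pi_elems[OF p k] subset_pi_elems G(2)]
  by simp

lemma fpi_self: "subfield k \<Longrightarrow> fpi k k"
  by (simp add: fpi_def subset_pi_elems findim_self)

lemma fpi_intermediate:
  assumes L: "fpi k L" and M: "subfield M" "k \<subseteq> M" "M \<subseteq> L"
  shows "fpi k M" "fpi M L"
  using findim_intermediate[OF fpiD(1)[OF L] M(1) fpiD(2)[OF L] M(2,3) fpiD(5)[OF L]]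
    fpiD[OF L] M pi_elems_mono[OF M(2)] unfolding fpi_def by auto

lemma fpi_generators:
  assumes L: "fpi k L"
  obtains G where "finite G" "G \<subseteq> L" "gen k G = L"
proof -
  obtain B where B: "finite B" "L = span_over k B"
    using findim_vdim[OF fpiD(1,5)[OF L]] vdimE by metis
  have "B \<subseteq> L" using span_over_subset[OF fpiD(1)[OF L] B(1)] B(2) by simp
  moreover have "gen k B = L"
    using span_over_least[OF subfield_gen gen_base gen_superset, of k B] B(2) fpiD(2,3)[OF L] calculation
    by (intro gen_eqI) auto
  ultimately show thesis using that B(1) by blast
qed

lemma finite_subset_chain_Union:
  fixes F :: "nat \<Rightarrow> 'a set"
  assumes "finite G" "G \<subseteq> (\<Union>n. F n)" "\<And>m n. m \<le> n \<Longrightarrow> F m \<subseteq> F n"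
  shows "\<exists>n. G \<subseteq> F n"
  using assms(1,2)
proof (induction G rule: finite_induct)
  case (insert x G)
  then obtain m n where "G \<subseteq> F n" "x \<in> F m" by auto
  then have "insert x G \<subseteq> F (max m n)"
    using assms(3)[of n "max m n"] assms(3)[of m "max m n"] by auto
  then show ?case ..
qed simp

text \<open>Finitely many generators have a common exponent n, and \<open>proot k n\<close> is a
  field containing \<open>k\<close>, so it contains everything they generate.\<close>

lemma fpi_exponent:
  fixes k :: "'a::field set"
  assumes p: "CHAR('a) > 0" and L: "fpi k L"
  obtains n where "ppow L n \<subseteq> k"
proof -
  obtain G where G: "finite G" "G \<subseteq> L" "gen k G = L" using fpi_generators[OF L] by metis
  have "G \<subseteq> (\<Union>n. proot k n)" using G(2) fpiD(4)[OF L] unfolding pi_elems_eq by (rule order_trans)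
  then have "\<exists>n. G \<subseteq> proot k n"
    by (rule finite_subset_chain_Union[OF G(1)]) (rule proot_mono[OF fpiD(1)[OF L]])
  then obtain n where n: "G \<subseteq> proot k n" ..
  have "k \<subseteq> proot k n" using proot_mono[OF fpiD(1)[OF L], of 0 n] by (simp add: proot_def)
  then have "L \<subseteq> proot k n"
    using gen_least[OF subfield_proot[OF p fpiD(1)[OF L]] _ n] G(3) by blast
  then show thesis using that ppow_subset_iff by blast
qed

text \<open>The purely inseparable counterpart of Nakayama's lemma.\<close>

lemma gen_eq_if_gen_over_ppow:
  fixes k :: "'a::field set"
  assumes p: "CHAR('a) > 0" and L: "fpi k L" and eq: "gen (gen k (ppow L 1)) G = L"
  shows "gen k G = L"
proof -
  let ?N = "gen k G"
  have GL: "G \<subseteq> L" using gen_superset[of G "gen k (ppow L 1)"] eq by simp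
  have NL: "?N \<subseteq> L" by (rule gen_least[OF fpiD(2,3)[OF L] GL])
  have step: "gen ?N (ppow L 1) = L" using eq by (simp add: gen_gen Un_commute)
  \<comment> \<open>Frobenius applied to L = N(L^(p^m)) gives L^p inside N(L^(p^(m+1))), and L =
    N(L^p) then raises m by one. At the exponent of L/k the adjoined powers lie in \<open>k\<close>,
    leaving L = N.\<close>
  have "L \<subseteq> gen ?N (ppow L m)" for m
  proof (induction m)
    case 0
    show ?case using gen_superset by simp
  next
    case (Suc m)
    have "ppow (gen ?N (ppow L m)) 1 \<subseteq> gen ?N (ppow L (Suc m))"
    proof (rule ppow_gen_subset[OF p subfield_gen])
      show "ppow ?N 1 \<subseteq> gen ?N (ppow L (Suc m))"
        using ppow_subset[of ?N 1] gen_base[of ?N "ppow L (Suc m)"] by auto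
      show "ppow (ppow L m) 1 \<subseteq> gen ?N (ppow L (Suc m))"
        using gen_superset by (simp add: ppow_ppow)
    qed
    then have "ppow L 1 \<subseteq> gen ?N (ppow L (Suc m))" using ppow_mono[OF Suc, of 1] by blast
    then have "gen ?N (ppow L 1) \<subseteq> gen ?N (ppow L (Suc m))" by (rule gen_least[OF subfield_gen gen_base])
    then show ?case using step by simp
  qed
  moreover obtain n where "ppow L n \<subseteq> k" by (rule fpi_exponent[OF p L])
  then have "gen ?N (ppow L n) = ?N" using gen_base[of k G] by (intro gen_absorb) auto
  ultimately have "L \<subseteq> ?N" by metis
  then show ?thesis using NL by blast
qed

text \<open>The logarithm to base p of [L : k(L^p)]. Defining the rank through a degree makes it
  comparable by multiplicativity in towers; \<open>mgs_card_eq_prank\<close> recovers the size of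
  minimal generating sets.\<close>

definition prank :: "'a::field set \<Rightarrow> 'a set \<Rightarrow> nat" where
  "prank k L = (THE r. deg (gen k (ppow L 1)) L = CHAR('a) ^ r)"

lemma prank_eqI:
  fixes k :: "'a::field set"
  assumes p: "CHAR('a) > 0" and r: "deg (gen k (ppow L 1)) L = CHAR('a) ^ r"
  shows "prank k L = r"
proof -
  have "1 < CHAR('a)" using prime_gt_1_nat[OF prime_CHAR_semidom[OF p]] .
  then show ?thesis unfolding prank_def r by (intro the_equality) auto
qed

lemma gen_ppow_intermediate:
  assumes "fpi k L"
  shows "gen k (ppow L n) \<subseteq> L" "fpi k (gen k (ppow L n))" "fpi (gen k (ppow L n)) L"
proof -
  show *: "gen k (ppow L n) \<subseteq> L"
    by (rule gen_least[OF fpiD(2,3)[OF assms] ppow_subset[OF fpiD(2)[OF assms]]])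
  show "fpi k (gen k (ppow L n))" "fpi (gen k (ppow L n)) L"
    using fpi_intermediate[OF assms subfield_gen gen_base *] by auto
qed

text \<open>Above k(L^p) the extension has exponent at most one, so greedy selection applies.
  \<open>M\<close> is left general to allow both k(L^p) itself and k(L^p)(a).\<close>

lemma prank_generators_over:
  fixes k :: "'a::field set"
  assumes p: "CHAR('a) > 0" and L: "fpi k L" and M: "subfield M" "gen k (ppow L 1) \<subseteq> M" "M \<subseteq> L"
    and G: "finite G" "gen M G = L"
  shows "\<exists>G'\<subseteq>G. gen M G' = L \<and> deg M L = CHAR('a) ^ card G'"
proof -
  have "x ^ CHAR('a) \<in> M" if "x \<in> G" for x
  proof -
    have "x \<in> L" using that gen_superset[of G M] G(2) by blast
    then have "x ^ CHAR('a) \<in> ppow L 1" by (simp add: ppow_def)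
    then show ?thesis using gen_superset[of "ppow L 1" k] M(2) by blast
  qed
  then obtain G' where "G' \<subseteq> G" "gen M G' = gen M G" "vdim (CHAR('a) ^ card G') M (gen M G')"
    using p_generating_subset[OF p M(1) G(1)] by blast
  then show ?thesis using deg_eqI[OF M(1)] G(2) by (intro exI[of _ G']) simp
qed

text \<open>Select greedily over k(L^p), then lift the selected generators to \<open>k\<close> by
  \<open>gen_eq_if_gen_over_ppow\<close>.\<close>

lemma prank_generators:
  fixes k :: "'a::field set"
  assumes p: "CHAR('a) > 0" and L: "fpi k L" and G: "finite G" "gen k G = L"
  shows "\<exists>G'\<subseteq>G. gen k G' = L \<and> card G' = prank k L \<and> deg (gen k (ppow L 1)) L = CHAR('a) ^ prank k L"
proof -
  let ?M = "gen k (ppow L 1)"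
  have "gen ?M G = gen L (ppow L 1)" using G(2) by (simp add: gen_gen Un_commute flip: gen_gen[of k G])
  then have "gen ?M G = L" using gen_absorb[OF fpiD(2)[OF L] ppow_subset[OF fpiD(2)[OF L]]] by simp
  then obtain G' where G': "G' \<subseteq> G" "gen ?M G' = L" "deg ?M L = CHAR('a) ^ card G'"
    using prank_generators_over[OF p L subfield_gen order_refl gen_ppow_intermediate(1)[OF L] G(1)] by blast
  have "prank k L = card G'" by (rule prank_eqI[OF p G'(3)])
  moreover have "gen k G' = L" by (rule gen_eq_if_gen_over_ppow[OF p L G'(2)])
  ultimately show ?thesis using G' by (intro exI[of _ G']) simp
qed

lemma prank_minimal_generators:
  fixes k :: "'a::field set"
  assumes p: "CHAR('a) > 0" and L: "fpi k L"
  obtains G where "finite G" "G \<subseteq> L" "gen k G = L" "card G = prank k L"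
proof -
  obtain G where G: "finite G" "G \<subseteq> L" "gen k G = L" using fpi_generators[OF L] by metis
  from prank_generators[OF p L G(1,3)]
  obtain G' where G': "G' \<subseteq> G" "gen k G' = L" "card G' = prank k L" by blast
  show thesis
    by (rule that[of G']) (use G G' finite_subset in auto)
qed

lemma deg_prank:
  fixes k :: "'a::field set"
  assumes p: "CHAR('a) > 0" and L: "fpi k L"
  shows "deg (gen k (ppow L 1)) L = CHAR('a) ^ prank k L"
proof -
  obtain G where G: "finite G" "G \<subseteq> L" "gen k G = L" using fpi_generators[OF L] by metis
  show ?thesis using prank_generators[OF p L G(1,3)] by blast
qed

lemma prank_le_card:
  fixes k :: "'a::field set"
  assumes p: "CHAR('a) > 0" and L: "fpi k L" and G: "finite G" "gen k G = L"
  shows "prank k L \<le> card G"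
proof -
  obtain G' where "G' \<subseteq> G" "card G' = prank k L" using prank_generators[OF p L G] by blast
  then show ?thesis using card_mono[OF G(1), of G'] by simp
qed

text \<open>The counterpart of completing a nonzero vector to a basis: adjoining \<open>a\<close> to
  k(L^p) uses up exactly one factor p of the degree, and the remaining factors bound the number of
  further generators.\<close>

lemma prank_generators_through:
  fixes k :: "'a::field set"
  assumes p: "CHAR('a) > 0" and L: "fpi k L" and a: "a \<in> L" "a \<notin> gen k (ppow L 1)"
  obtains G where "finite G" "Suc (card G) = prank k L" "gen k (insert a G) = L"
proof -
  let ?M = "gen k (ppow L 1)"
  let ?M' = "gen ?M {a}"
  have le1: "?M \<subseteq> L" by (rule gen_ppow_intermediate(1)[OF L])
  have le2: "?M' \<subseteq> L" by (rule gen_least[OF fpiD(2)[OF L] le1]) (use a in simp)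
  obtain G where G: "finite G" "G \<subseteq> L" "gen k G = L" using fpi_generators[OF L] by metis
  have "gen ?M' G = L"
  proof (rule gen_eqI[OF fpiD(2)[OF L] le2 G(2)])
    have "k \<subseteq> ?M'" using gen_base by blast
    then show "L \<subseteq> gen ?M' G" using G(3) gen_mono[of k ?M' G G] by blast
  qed
  then obtain G' where G': "G' \<subseteq> G" "gen ?M' G' = L" "deg ?M' L = CHAR('a) ^ card G'"
    using prank_generators_over[OF p L subfield_gen gen_base le2 G(1)] by blast
  have "a ^ CHAR('a) \<in> ppow L 1" using a by (simp add: ppow_def)
  then have "a ^ CHAR('a) \<in> ?M" using gen_superset by blast
  then have "deg ?M ?M' = CHAR('a)"
    by (rule deg_eqI[OF subfield_gen vdim_simple_extension[OF p subfield_gen _ a(2)]])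
  then have "deg ?M L = CHAR('a) ^ Suc (card G')"
    using deg_tower[OF subfield_gen subfield_gen fpiD(2)[OF L] gen_base le2 fpiD(5)[OF gen_ppow_intermediate(3)[OF L]]]
      G'(3) by simp
  then have "prank k L = Suc (card G')" by (rule prank_eqI[OF p])
  moreover have "gen ?M (insert a G') = L" using G'(2) by (simp add: gen_gen)
  then have "gen k (insert a G') = L" by (rule gen_eq_if_gen_over_ppow[OF p L])
  ultimately show thesis using that[of G'] finite_subset[OF G'(1) G(1)] by simp
qed

text \<open>Factor [L' : k(L^p)] through L and through k(L'^p). The step from k(L^p) to k(L'^p) is a
  compositum of L'^p over L^p, so its degree is at most [L'^p : L^p] = [L' : L]; cancelling [L' : L]
  leaves the comparison of ranks.\<close>

lemma prank_mono:
  fixes k :: "'a::field set"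
  assumes p: "CHAR('a) > 0" and L': "fpi k L'" and L: "subfield L" "k \<subseteq> L" "L \<subseteq> L'"
  shows "prank k L \<le> prank k L'"
proof -
  let ?N = "gen k (ppow L 1)" and ?N' = "gen k (ppow L' 1)"
  note fL = fpi_intermediate[OF L' L]
  have NL: "?N \<subseteq> L" by (rule gen_ppow_intermediate(1)[OF fL(1)])
  have NN': "?N \<subseteq> ?N'" by (intro gen_mono ppow_mono L order_refl)
  have N'L': "?N' \<subseteq> L'" by (rule gen_ppow_intermediate(1)[OF L'])
  have fN: "fpi ?N L'" using fpi_intermediate(2)[OF L' subfield_gen gen_base] NL L(3) by blast
  have fN': "fpi ?N ?N'" by (rule fpi_intermediate(1)[OF fN subfield_gen NN' N'L'])
  have eq: "gen ?N (ppow L' 1) = ?N'"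
  proof (rule antisym)
    show "gen ?N (ppow L' 1) \<subseteq> ?N'" by (rule gen_least[OF subfield_gen NN' gen_superset])
    show "?N' \<subseteq> gen ?N (ppow L' 1)" by (rule gen_mono[OF gen_base order_refl])
  qed
  have "ppow L' 1 \<subseteq> pi_elems ?N" using fpiD(4)[OF fN'] gen_superset[of "ppow L' 1" k] by blast
  then have "deg ?N (gen ?N (ppow L' 1)) \<le> deg (ppow L 1) (ppow L' 1)"
    by (rule deg_compositum_le(2)[OF p subfield_ppow[OF p L(1)] subfield_gen
        subfield_ppow[OF p fpiD(2)[OF L']] gen_superset deg_ppow(1)[OF p L(1) fpiD(5)[OF fL(2)]]])
  also have "\<dots> = deg L L'" by (rule deg_ppow(2)[OF p L(1) fpiD(5)[OF fL(2)]])
  finally have le: "deg ?N ?N' \<le> deg L L'" unfolding eq .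
  have "deg ?N L * deg L L' = deg ?N L'"
    by (rule deg_tower[OF subfield_gen L(1) fpiD(2)[OF L'] NL L(3) fpiD(5)[OF fN], symmetric])
  also have "\<dots> = deg ?N ?N' * deg ?N' L'"
    by (rule deg_tower[OF subfield_gen subfield_gen fpiD(2)[OF L'] NN' N'L' fpiD(5)[OF fN]])
  also have "\<dots> \<le> deg L L' * deg ?N' L'" using le by simp
  finally have "deg ?N L \<le> deg ?N' L'"
    using deg_pos[OF L(1) fpiD(2)[OF L'] fpiD(5)[OF fL(2)]] by (simp add: mult.commute)
  then have "CHAR('a) ^ prank k L \<le> CHAR('a) ^ prank k L'"
    using deg_prank[OF p fL(1)] deg_prank[OF p L'] by simp
  then show ?thesis
    using prime_gt_1_nat[OF prime_CHAR_semidom[OF p]] by simp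
qed

text \<open>An irredundant generating set over \<open>k\<close> stays irredundant over k(L^p):
  otherwise the smaller set would generate L over k(L^p), hence over \<open>k\<close>. Its size can
  then be read off a degree.\<close>

lemma prank_min_gen_set:
  fixes k :: "'a::field set"
  assumes p: "CHAR('a) > 0" and L: "fpi k L" and G: "min_gen_set k L G" "finite G"
  shows "card G = prank k L"
proof -
  let ?M = "gen k (ppow L 1)"
  have GL: "G \<subseteq> L" "gen k G = L" and ind: "\<And>x. x \<in> G \<Longrightarrow> x \<notin> gen k (G - {x})"
    using G(1) unfolding min_gen_set_def by auto
  have gM: "gen ?M G = L"
  proof (rule gen_eqI[OF fpiD(2)[OF L] gen_ppow_intermediate(1)[OF L] GL(1)])
    show "L \<subseteq> gen ?M G" using gen_mono[OF gen_base order_refl, of k G] GL(2) by blast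
  qed
  have pM: "x ^ CHAR('a) \<in> ?M" if "x \<in> G" for x
    using that GL(1) gen_superset[of "ppow L 1" k] by (auto simp: ppow_def)
  have "vdim (CHAR('a) ^ card G) ?M (gen ?M G)"
  proof (rule vdim_p_independent[OF p subfield_gen G(2) pM])
    fix x assume x: "x \<in> G"
    show "x \<notin> gen ?M (G - {x})"
    proof
      assume "x \<in> gen ?M (G - {x})"
      then have "G \<subseteq> gen ?M (G - {x})" using gen_superset[of "G - {x}" ?M] by blast
      then have "gen ?M G \<subseteq> gen ?M (G - {x})" by (rule gen_least[OF subfield_gen gen_base])
      moreover have "gen ?M (G - {x}) \<subseteq> gen ?M G" by (intro gen_mono) auto
      ultimately have "gen k (G - {x}) = L"
        using gM by (intro gen_eq_if_gen_over_ppow[OF p L]) simp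
      then show False using ind[OF x] x GL(1) by blast
    qed
  qed
  then have "deg ?M L = CHAR('a) ^ card G" using deg_eqI[OF subfield_gen, of _ k "ppow L 1"] gM by simp
  then show ?thesis using prank_eqI[OF p] by simp
qed

text \<open>A generating set of size \<open>prank k L\<close> is irredundant, because fewer
  generators contradict \<open>prank_le_card\<close>; this bounds the infimum from above. Infinite
  minimal generating sets cannot lower it, as their \<open>ecard\<close> is infinite.\<close>

lemma mgs_card_eq_prank:
  fixes k :: "'a::field set"
  assumes p: "CHAR('a) > 0" and L: "fpi k L"
  shows "mgs_card k L = enat (prank k L)"
proof (rule antisym)
  obtain G where G: "finite G" "G \<subseteq> L" "gen k G = L" "card G = prank k L"
    using prank_minimal_generators[OF p L] .
  have "x \<notin> gen k (G - {x})" if x: "x \<in> G" for x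
  proof
    assume "x \<in> gen k (G - {x})"
    then have "G \<subseteq> gen k (G - {x})" using gen_superset[of "G - {x}" k] by blast
    then have "gen k G \<subseteq> gen k (G - {x})" by (rule gen_least[OF subfield_gen gen_base])
    moreover have "gen k (G - {x}) \<subseteq> gen k G" by (intro gen_mono) auto
    ultimately have "gen k (G - {x}) = L" using G(3) by simp
    then have "prank k L \<le> card (G - {x})" using prank_le_card[OF p L] G(1) by simp
    moreover have "card (G - {x}) < card G" using x G(1) by (intro psubset_card_mono) auto
    ultimately show False using G(4) by simp
  qed
  then have "min_gen_set k L G" using G unfolding min_gen_set_def by simp
  then have "mgs_card k L \<le> ecard G" unfolding mgs_card_def by (intro INF_lower) simp
  then show "mgs_card k L \<le> enat (prank k L)" using G by (simp add: ecard_def)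
next
  show "enat (prank k L) \<le> mgs_card k L"
    unfolding mgs_card_def
  proof (rule INF_greatest)
    fix G assume "G \<in> {G. min_gen_set k L G}"
    then show "enat (prank k L) \<le> ecard G"
      using prank_min_gen_set[OF p L, of G] by (simp add: ecard_def)
  qed
qed

lemma fpi_if_mgs_card_finite:
  fixes k :: "'a::field set"
  assumes p: "CHAR('a) > 0" and k: "subfield k" and L: "L \<subseteq> pi_elems k" and fin: "mgs_card k L < \<infinity>"
  shows "fpi k L"
proof -
  obtain G where G: "min_gen_set k L G" "ecard G < \<infinity>"
    using fin unfolding mgs_card_def INF_less_iff by auto
  then have "finite G" "G \<subseteq> L" "gen k G = L"
    by (auto simp: min_gen_set_def ecard_def split: if_splits)
  then show ?thesis using fpi_gen[OF p k, of G] L by auto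
qed

lemma subfield_kn:
  fixes k :: "'a::field set"
  assumes "CHAR('a) > 0" "subfield k" "subfield K" shows "subfield (kn k K n)"
  unfolding kn_def by (intro subfield_Int subfield_proot assms)

text \<open>The filtration reaches L at its exponent, and by \<open>prank_mono\<close> no earlier
  stage has larger rank.\<close>

lemma di_eq_prank:
  fixes k :: "'a::field set"
  assumes p: "CHAR('a) > 0" and L: "fpi k L"
  shows "di k L = enat (prank k L)"
proof (rule antisym)
  have kn: "subfield (kn k L n)" "k \<subseteq> kn k L n" "kn k L n \<subseteq> L" for n
  proof -
    show "subfield (kn k L n)" by (rule subfield_kn[OF p fpiD(1,2)[OF L]])
    show "k \<subseteq> kn k L n" using proot_mono[OF fpiD(1)[OF L], of 0 n] fpiD(3)[OF L] by (auto simp: kn_def proot_def)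
  qed (simp add: kn_def)
  have eq: "mgs_card k (kn k L n) = enat (prank k (kn k L n))" for n
    by (rule mgs_card_eq_prank[OF p fpi_intermediate(1)[OF L kn]])
  show "di k L \<le> enat (prank k L)"
    unfolding di_def eq by (intro SUP_least) (simp add: prank_mono[OF p L kn])
  obtain n where "ppow L n \<subseteq> k" by (rule fpi_exponent[OF p L])
  then have "kn k L n = L" by (auto simp: kn_def ppow_subset_iff)
  then show "enat (prank k L) \<le> di k L"
    unfolding di_def using SUP_upper[of n UNIV "\<lambda>n. mgs_card k (kn k L n)"] eq[of n] by simp
qed

section \<open>Rank under Frobenius powers and change of base\<close>

lemma prank_gen_ppow_le_card:
  fixes k :: "'a::field set"
  assumes p: "CHAR('a) > 0" and k: "subfield k" and G: "finite G" "ppow G n \<subseteq> pi_elems k"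
  shows "fpi k (gen k (ppow G n))" "prank k (gen k (ppow G n)) \<le> card G"
proof -
  have fin: "finite (ppow G n)" using G(1) by (simp add: ppow_def)
  show f: "fpi k (gen k (ppow G n))" by (rule fpi_gen[OF p k fin G(2)])
  have "prank k (gen k (ppow G n)) \<le> card (ppow G n)" by (rule prank_le_card[OF p f fin refl])
  also have "\<dots> \<le> card G" unfolding ppow_def using card_image_le[OF G(1)] .
  finally show "prank k (gen k (ppow G n)) \<le> card G" .
qed

text \<open>If \<open>a\<close> were outside k(L^p), it could belong to a generating set of minimal
  size. Since a^(p^n) lies in \<open>k\<close>, the p^n-th powers of the other generators alone
  would generate k(L^(p^n)), so the rank would have dropped.\<close>

lemma mem_gen_ppow_if_prank_stable:
  fixes k :: "'a::field set"
  assumes p: "CHAR('a) > 0" and L: "fpi k L"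
    and rank: "prank k L \<le> prank k (gen k (ppow L n))"
    and a: "a \<in> L" "a ^ (CHAR('a) ^ n) \<in> k"
  shows "a \<in> gen k (ppow L 1)"
proof (rule ccontr)
  assume "a \<notin> gen k (ppow L 1)"
  then obtain G where G: "finite G" "Suc (card G) = prank k L" "gen k (insert a G) = L"
    by (rule prank_generators_through[OF p L a(1)])
  have GL: "G \<subseteq> L" using gen_superset[of "insert a G" k] G(3) by blast
  have "gen k (ppow L n) = gen k (ppow (insert a G) n)"
    unfolding G(3)[symmetric] by (rule gen_ppow_gen[OF p fpiD(1)[OF L]])
  also have "\<dots> = gen (gen k {a ^ (CHAR('a) ^ n)}) (ppow G n)" by (simp add: gen_gen ppow_def)
  also have "gen k {a ^ (CHAR('a) ^ n)} = k" using a(2) by (intro gen_absorb[OF fpiD(1)[OF L]]) simp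
  finally have eq: "gen k (ppow L n) = gen k (ppow G n)" .
  have "ppow G n \<subseteq> pi_elems k"
    using ppow_mono[OF GL, of n] ppow_subset[OF fpiD(2)[OF L], of n] fpiD(4)[OF L] by blast
  then have "prank k (gen k (ppow L n)) \<le> card G"
    unfolding eq by (rule prank_gen_ppow_le_card(2)[OF p fpiD(1)[OF L] G(1)])
  then show False using rank G(2) by simp
qed

text \<open>A generating set of M over \<open>k\<close> still generates the compositum over
  \<open>L\<close>.\<close>

lemma prank_base_change:
  fixes k :: "'a::field set"
  assumes p: "CHAR('a) > 0" and M: "fpi k M" and L: "subfield L" "k \<subseteq> L"
  shows "fpi L (gen L M)" "prank L (gen L M) \<le> prank k M"
proof -
  obtain G where G: "finite G" "G \<subseteq> M" "gen k G = M" "card G = prank k M"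
    using prank_minimal_generators[OF p M] .
  have eq: "gen L M = gen L G"
  proof (rule antisym)
    have "M \<subseteq> gen L G" using gen_mono[OF L(2) order_refl, of G] G(3) by simp
    then show "gen L M \<subseteq> gen L G" by (rule gen_least[OF subfield_gen gen_base])
    show "gen L G \<subseteq> gen L M" by (rule gen_mono[OF order_refl G(2)])
  qed
  have "G \<subseteq> pi_elems L" using G(2) fpiD(4)[OF M] pi_elems_mono[OF L(2)] by blast
  then show f: "fpi L (gen L M)" unfolding eq by (rule fpi_gen[OF p L(1) G(1)])
  show "prank L (gen L M) \<le> prank k M" using prank_le_card[OF p f G(1) eq[symmetric]] G(4) by simp
qed

section \<open>The filtration of a q-finite extension\<close>

text \<open>Finiteness of the irrationality degree, as a uniform bound \<open>d\<close> on the ranks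
  of the k_j. A locale is used because the theory is instantiated again over finite intermediate
  fields, with the same \<open>d\<close>.\<close>

locale qext =
  fixes k K :: "'a::field set" and d :: nat
  assumes p: "CHAR('a) > 0" and k: "subfield k" and K: "subfield K" and kK: "k \<subseteq> K"
    and Kpi: "K \<subseteq> pi_elems k"
    and fpi_kn: "fpi k (kn k K j)" and prank_kn: "prank k (kn k K j) \<le> d"
begin

lemma kn_mono: "i \<le> j \<Longrightarrow> kn k K i \<subseteq> kn k K j"
  unfolding kn_def using proot_mono[OF k] by blast

lemma kn_0 [simp]: "kn k K 0 = k"
  using kK by (auto simp: kn_def proot_def)

lemma kn_subset: "kn k K j \<subseteq> K"
  by (simp add: kn_def)

lemma K_eq_Union_kn: "K = (\<Union>j. kn k K j)"
  using Kpi by (auto simp: kn_def pi_elems_eq)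

lemma ppow_kn: "ppow (kn k K (j + n)) n \<subseteq> kn k K j"
  using subfieldD(9)[OF K]
  by (auto simp: kn_def ppow_def proot_def power_add power_mult simp flip: power_mult)
    (simp add: mult.commute)

definition E :: "nat \<Rightarrow> nat \<Rightarrow> 'a set" where
  "E j m = gen k (ppow (kn k K j) m)"

text \<open>For fixed \<open>j\<close> this is the partition conjugate to the exponents of k_j/k:
  \<open>D j m\<close> is the number of s >= 1 with o_s(k_j/k) > m.\<close>

definition D :: "nat \<Rightarrow> nat \<Rightarrow> nat" where
  "D j m = prank k (E j m)"

lemma fpi_E: "fpi k (E j m)"
  unfolding E_def by (rule gen_ppow_intermediate(2)[OF fpi_kn])

lemma subfield_E [simp]: "subfield (E j m)"
  by (simp add: E_def)

lemma k_subset_E: "k \<subseteq> E j m"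
  unfolding E_def by (rule gen_base)

lemma E_0: "E j 0 = kn k K j"
  unfolding E_def ppow_0 by (rule gen_eqI[OF fpiD(2)[OF fpi_kn] fpiD(3)[OF fpi_kn] order_refl gen_superset])

lemma gen_ppow_E: "gen k (ppow (E j m) n) = E j (m + n)"
  unfolding E_def by (simp add: gen_ppow_gen[OF p k] ppow_ppow)

lemma E_mono: "i \<le> j \<Longrightarrow> E i m \<subseteq> E j m"
  unfolding E_def by (intro gen_mono ppow_mono kn_mono order_refl)

lemma E_add_subset: "E j (m + n) \<subseteq> E j m"
  unfolding gen_ppow_E[symmetric] by (rule gen_ppow_intermediate(1)[OF fpi_E])

lemma E_antimono: "m \<le> n \<Longrightarrow> E j n \<subseteq> E j m"
  using E_add_subset[of j m "n - m"] by simp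

text \<open>Frobenius lowers the filtration index: (k_(j+n))^(p^n) lies in k_j.\<close>

lemma E_add_add_subset: "E (j + n) (m + n) \<subseteq> E j m"
proof -
  have "ppow (kn k K (j + n)) (m + n) = ppow (ppow (kn k K (j + n)) n) m"
    by (simp add: ppow_ppow add.commute)
  also have "\<dots> \<subseteq> ppow (kn k K j) m" by (intro ppow_mono ppow_kn)
  finally show ?thesis unfolding E_def by (intro gen_mono order_refl)
qed

lemma E_eq_base: "j \<le> m \<Longrightarrow> E j m = k"
  using E_add_add_subset[of 0 j "m - j"] k_subset_E[of j m] by (simp add: E_def gen_absorb[OF k ppow_subset[OF k]])

lemma E_subset_kn: "E j m \<subseteq> kn k K j"
  using E_antimono[of 0 m j] by (simp add: E_0)

lemma D_mono: "i \<le> j \<Longrightarrow> D i m \<le> D j m"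
  unfolding D_def by (rule prank_mono[OF p fpi_E subfield_E k_subset_E E_mono])

lemma D_antimono: "m \<le> n \<Longrightarrow> D j n \<le> D j m"
  unfolding D_def by (rule prank_mono[OF p fpi_E subfield_E k_subset_E E_antimono])

lemma D_le: "D j m \<le> d"
  using D_antimono[of 0 m j] prank_kn[of j] by (simp add: D_def E_0)

lemma deg_E_Suc: "deg (E j (Suc m)) (E j m) = CHAR('a) ^ D j m"
  using deg_prank[OF p fpi_E, of j m] gen_ppow_E[of j m 1] by (simp add: D_def)

lemma fpi_E_E: "m \<le> n \<Longrightarrow> fpi (E j n) (E j m)"
  by (rule fpi_intermediate(2)[OF fpi_E subfield_E k_subset_E E_antimono])

lemma deg_E_E: "deg (E j (m + n)) (E j m) = CHAR('a) ^ (\<Sum>i<n. D j (m + i))"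
proof (induction n)
  case 0
  show ?case using deg_self[OF subfield_E] by simp
next
  case (Suc n)
  have "deg (E j (m + Suc n)) (E j m) = deg (E j (m + Suc n)) (E j (m + n)) * deg (E j (m + n)) (E j m)"
    by (rule deg_tower[OF subfield_E subfield_E subfield_E E_antimono E_antimono fpiD(5)[OF fpi_E_E]]) auto
  then show ?case using Suc deg_E_Suc[of j "m + n"] by (simp add: power_add)
qed

text \<open>The chain E j 0, E j 1, ... descends from k_j and reaches \<open>k\<close> at m =
  j.\<close>

lemma deg_kn: "deg k (kn k K j) = CHAR('a) ^ (\<Sum>i<j. D j i)"
  using deg_E_E[of j 0 j] by (simp add: E_0 E_eq_base)

lemma di_E: "di k (E j m) = enat (D j m)"
  unfolding D_def by (rule di_eq_prank[OF p fpi_E])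

section \<open>Stabilisation of the ranks and the relatively perfect part\<close>

definition stable :: "nat \<Rightarrow> nat \<Rightarrow> bool" where
  "stable t e \<longleftrightarrow> (\<forall>m\<ge>e. (\<forall>j. D j m \<le> t) \<and> (\<exists>j. D j m = t))"

text \<open>The maximum over j of \<open>D j m\<close> exists thanks to the bound \<open>d\<close>
  and is nonincreasing in m, so it is constant from any minimising index on. \<open>di_rp\<close>
  identifies the constant with the irrationality degree of rp(K/k).\<close>

lemma stable_exists: "\<exists>t e. stable t e"
proof -
  define T where "T m = Max (range (\<lambda>j. D j m))" for m
  have fin: "finite (range (\<lambda>j. D j m))" for m
    by (rule finite_subset[of _ "{..d}"]) (use D_le in auto)
  have le: "D j m \<le> T m" for j m unfolding T_def using fin by (intro Max_ge) auto
  have ex: "\<exists>j. D j m = T m" for m using Max_in[OF fin, of m] unfolding T_def by auto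
  obtain e where e: "\<And>m. T e \<le> T m"
    using ex_has_least_nat[of "\<lambda>_. True" 0 T] by auto
  have eq: "T m = T e" if m: "e \<le> m" for m
  proof (rule antisym[OF _ e])
    obtain j where "D j m = T m" using ex[of m] ..
    then show "T m \<le> T e" using D_antimono[OF m, of j] le[of j e] by simp
  qed
  have "stable (T e) e"
    unfolding stable_def
  proof (intro allI impI conjI)
    fix m j assume m: "e \<le> m"
    show "D j m \<le> T e" using le[of j m] eq[OF m] by simp
    show "\<exists>j. D j m = T e" using ex[of m] eq[OF m] by simp
  qed
  then show ?thesis by blast
qed

lemma gen_ppow_eq_Union_E: "gen k (ppow K m) = (\<Union>j. E j m)"
proof (rule gen_eqI)
  show "subfield (\<Union>j. E j m)" by (rule subfield_chain_Union) (use E_mono in auto)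
  show "k \<subseteq> (\<Union>j. E j m)" using k_subset_E by blast
  show "ppow K m \<subseteq> (\<Union>j. E j m)"
    unfolding E_def ppow_def using gen_superset[of "(\<lambda>x. x ^ CHAR('a) ^ m) ` kn k K j" k for j]
    by (subst K_eq_Union_kn) (auto simp: image_UN intro!: gen_superset[THEN subsetD])
  show "(\<Union>j. E j m) \<subseteq> gen k (ppow K m)"
    unfolding E_def by (intro UN_least gen_mono ppow_mono kn_subset order_refl)
qed

lemma gen_ppow_gen_ppow: "gen k (ppow (gen k (ppow K m)) n) = gen k (ppow K (m + n))"
  by (simp add: gen_ppow_gen[OF p k] ppow_ppow)

lemma D_eventually_ge: "stable t e \<Longrightarrow> \<exists>j0. \<forall>j\<ge>j0. t \<le> D j m"
proof -
  assume st: "stable t e"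
  \<comment> \<open>The depth \<open>max m e\<close> makes the bound valid also for m below e, where
    ranks are only larger.\<close>
  obtain j0 where j0: "D j0 (max m e) = t" using st unfolding stable_def by (meson max.cobounded2)
  have "t \<le> D j m" if "j0 \<le> j" for j
    using D_mono[OF that, of "max m e"] D_antimono[of m "max m e" j] j0 by simp
  then show ?thesis by blast
qed

text \<open>This is what makes k(K^(p^e)) relatively perfect: an element of exponent n lies in some
  E i e whose rank does not drop under n further Frobenius steps, so
  \<open>mem_gen_ppow_if_prank_stable\<close> applies.\<close>

lemma stable_gen_ppow_subset:
  assumes st: "stable t e"
  shows "gen k (ppow K e) \<subseteq> gen k (ppow K (e + 1))"
proof
  fix x assume x: "x \<in> gen k (ppow K e)"
  then obtain j where j: "x \<in> E j e" unfolding gen_ppow_eq_Union_E by blast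
  then have "x \<in> pi_elems k" using fpiD(4)[OF fpi_E] by blast
  then obtain n where n: "x ^ (CHAR('a) ^ n) \<in> k" by (auto simp: pi_elems_def)
  obtain j0 where j0: "\<forall>j\<ge>j0. t \<le> D j (e + n)" using D_eventually_ge[OF st] by blast
  \<comment> \<open>Large enough both to contain \<open>x\<close> and to have rank at least t at
    depth e + n.\<close>
  define i where "i = max j j0"
  have "prank k (E i e) \<le> t" using st unfolding stable_def D_def by blast
  also have "t \<le> prank k (gen k (ppow (E i e) n))"
    using j0 unfolding gen_ppow_E D_def by (simp add: i_def)
  finally have "prank k (E i e) \<le> prank k (gen k (ppow (E i e) n))" .
  moreover have "x \<in> E i e" using j E_mono[of j i e] by (auto simp: i_def)
  ultimately have "x \<in> gen k (ppow (E i e) 1)"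
    by (rule mem_gen_ppow_if_prank_stable[OF p fpi_E _ _ n])
  then show "x \<in> gen k (ppow K (e + 1))"
    unfolding gen_ppow_E gen_ppow_eq_Union_E by blast
qed

text \<open>A relatively perfect L equals k(L^(p^n)) for every n, so with n = e it lies in
  k(K^(p^e)); that field is relatively perfect by stability, hence the largest one.\<close>

lemma rp_eq:
  assumes st: "stable t e"
  shows "rp k K = gen k (ppow K e)"
proof -
  let ?R = "gen k (ppow K e)"
  have RK: "?R \<subseteq> K" by (rule gen_least[OF K kK ppow_subset[OF K]])
  have "gen k (ppow K (e + 1)) \<subseteq> ?R"
    using ppow_mono[OF ppow_subset[OF K, of 1], of e] by (intro gen_mono) (auto simp: ppow_ppow)
  then have "gen k (ppow ?R 1) = ?R"
    unfolding gen_ppow_gen_ppow using stable_gen_ppow_subset[OF st] by (rule antisym)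
  then have perf: "rel_perfect k ?R" by (simp add: rel_perfect_def)
  have max: "L \<subseteq> ?R" if L: "intermediate k L K" "rel_perfect k L" for L
  proof -
    have "L = gen k (ppow L n)" for n
    proof (induction n)
      case 0
      show ?case using L(1) gen_eqI[of L k L] gen_superset[of L k] by (simp add: intermediate_def)
    next
      case (Suc n)
      have "L = gen k (ppow (gen k (ppow L n)) 1)" using Suc L(2) by (simp add: rel_perfect_def)
      then show ?case by (simp add: gen_ppow_gen[OF p k] ppow_ppow)
    qed
    then have "L = gen k (ppow L e)" .
    also have "\<dots> \<subseteq> ?R" using L(1) by (intro gen_mono ppow_mono) (auto simp: intermediate_def)
    finally show ?thesis .
  qed
  have int: "intermediate k ?R K" using RK gen_base by (simp add: intermediate_def)
  show ?thesis unfolding rp_def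
  proof (rule the_equality)
    show "intermediate k ?R K \<and> rel_perfect k ?R \<and>
      (\<forall>L'. intermediate k L' K \<and> rel_perfect k L' \<longrightarrow> L' \<subseteq> ?R)"
      using int perf max by simp
  next
    fix L assume L: "intermediate k L K \<and> rel_perfect k L \<and>
      (\<forall>L'. intermediate k L' K \<and> rel_perfect k L' \<longrightarrow> L' \<subseteq> L)"
    then have "?R \<subseteq> L" using int perf by simp
    moreover have "L \<subseteq> ?R" using L max by simp
    ultimately show "L = ?R" by simp
  qed
qed

text \<open>Two exhaustions of the same field are compared: by exponent, and by the fields E j e.
  Each stage of one lies in a stage of the other, and \<open>prank_mono\<close> transfers the
  bounds.\<close>

lemma di_rp:
  assumes st: "stable t e"
  shows "di k (rp k K) = enat t"
proof -
  let ?R = "gen k (ppow K e)"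
  have RK: "?R \<subseteq> K" by (rule gen_least[OF K kK ppow_subset[OF K]])
  have sub: "subfield (kn k ?R n)" "k \<subseteq> kn k ?R n" "kn k ?R n \<subseteq> kn k K n" for n
  proof -
    show "subfield (kn k ?R n)" by (rule subfield_kn[OF p k subfield_gen])
    show "k \<subseteq> kn k ?R n"
      using fpiD(3)[OF fpi_kn, of n] gen_base[of k "ppow K e"] by (auto simp: kn_def)
    show "kn k ?R n \<subseteq> kn k K n" using RK by (auto simp: kn_def)
  qed
  have fR: "fpi k (kn k ?R n)" for n by (rule fpi_intermediate(1)[OF fpi_kn sub])
  have "prank k (kn k ?R n) \<le> t" for n
  proof -
    obtain G where G: "finite G" "G \<subseteq> kn k ?R n" "gen k G = kn k ?R n" by (rule fpi_generators[OF fR])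
    have "G \<subseteq> (\<Union>j. E j e)" using G(2) unfolding gen_ppow_eq_Union_E by (auto simp: kn_def)
    then have "\<exists>j. G \<subseteq> E j e" by (rule finite_subset_chain_Union[OF G(1)]) (rule E_mono)
    then obtain j where "G \<subseteq> E j e" ..
    then have "kn k ?R n \<subseteq> E j e" unfolding G(3)[symmetric] by (rule gen_least[OF subfield_E k_subset_E])
    then have "prank k (kn k ?R n) \<le> D j e" unfolding D_def by (rule prank_mono[OF p fpi_E sub(1,2)])
    also have "\<dots> \<le> t" using st unfolding stable_def by blast
    finally show ?thesis .
  qed
  then have "di k ?R \<le> enat t"
    unfolding di_def mgs_card_eq_prank[OF p fR] by (intro SUP_least) simp
  moreover have "enat t \<le> di k ?R"
  proof -
    obtain j where j: "D j e = t" using st unfolding stable_def by blast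
    have "E j e \<subseteq> kn k ?R j"
      using E_subset_kn[of j e] gen_ppow_eq_Union_E[of e] by (auto simp: kn_def)
    then have "t \<le> prank k (kn k ?R j)"
      using prank_mono[OF p fR subfield_E k_subset_E] j unfolding D_def by blast
    then show ?thesis
      unfolding di_def mgs_card_eq_prank[OF p fR] by (intro SUP_upper2[of j]) auto
  qed
  ultimately show ?thesis unfolding rp_eq[OF st] by (rule antisym)
qed

section \<open>The sequences U and the index Ilqm in terms of D\<close>

lemma D_eq_0: "j \<le> m \<Longrightarrow> D j m = 0"
  using prank_le_card[OF p fpi_self[OF k], of "{}"] by (simp add: D_def E_eq_base gen_empty[OF k])

lemma o_exp_kn: "o_exp s k (kn k K j) = (LEAST m. D j m < s)"
  unfolding o_exp_def E_def[symmetric] di_E by simp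

text \<open>As o_s(k_j/k) is the least m with D j m < s, the bound j - o_s <= c says that D j m >= s
  for all m < j - c. The least m exists because s >= 1 and D j j = 0, which also gives o_s <=
  j.\<close>

lemma U_bounded_iff:
  assumes s: "1 \<le> s"
  shows "U_bounded s k K \<longleftrightarrow> (\<exists>c. \<forall>j m. m + c < j \<longrightarrow> s \<le> D j m)"
proof -
  have small: "D j (o_exp s k (kn k K j)) < s" for j
    unfolding o_exp_kn by (rule LeastI[of _ j]) (use s D_eq_0 in simp)
  have least: "o_exp s k (kn k K j) \<le> m" if "D j m < s" for j m
    unfolding o_exp_kn by (rule Least_le) (rule that)
  show ?thesis
  proof
    assume "U_bounded s k K"
    then obtain B where B: "\<And>j. \<bar>U s j k K\<bar> \<le> B" unfolding U_bounded_def by blast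
    have "s \<le> D j m" if "m + nat B < j" for j m
    proof (rule ccontr)
      assume "\<not> s \<le> D j m"
      then have "o_exp s k (kn k K j) \<le> m" by (intro least) simp
      then show False using B[of j] that unfolding U_def by linarith
    qed
    then show "\<exists>c. \<forall>j m. m + c < j \<longrightarrow> s \<le> D j m" by blast
  next
    assume "\<exists>c. \<forall>j m. m + c < j \<longrightarrow> s \<le> D j m"
    then obtain c where c: "\<And>j m. m + c < j \<Longrightarrow> s \<le> D j m" by blast
    have "\<bar>U s j k K\<bar> \<le> int c" for j
    proof -
      have "\<not> o_exp s k (kn k K j) + c < j" using c[of "o_exp s k (kn k K j)" j] small[of j] by auto
      moreover have "o_exp s k (kn k K j) \<le> j" by (rule least) (use s D_eq_0 in simp)
      ultimately show ?thesis unfolding U_def by linarith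
    qed
    then show "U_bounded s k K" unfolding U_bounded_def by blast
  qed
qed

text \<open>At depth e the ranks never exceed t, so o_(t+1) stays at most e while j grows.\<close>

lemma not_U_bounded_Suc:
  assumes st: "stable t e" shows "\<not> U_bounded (Suc t) k K"
proof
  assume "U_bounded (Suc t) k K"
  then obtain c where "\<And>j m. m + c < j \<Longrightarrow> Suc t \<le> D j m" unfolding U_bounded_iff[of "Suc t", simplified] by blast
  then have "Suc t \<le> D (e + c + 1) e" by simp
  moreover have "D (e + c + 1) e \<le> t" using st unfolding stable_def by blast
  ultimately show False by simp
qed

text \<open>The case s = t implies all smaller s with the same slack; for t = 0 both sides hold
  trivially.\<close>

lemma U_bounded_upto_iff:
  "(\<forall>s. 1 \<le> s \<and> s \<le> t \<longrightarrow> U_bounded s k K) \<longleftrightarrow> (\<exists>c. \<forall>j m. m + c < j \<longrightarrow> t \<le> D j m)"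
proof
  assume *: "\<forall>s. 1 \<le> s \<and> s \<le> t \<longrightarrow> U_bounded s k K"
  show "\<exists>c. \<forall>j m. m + c < j \<longrightarrow> t \<le> D j m"
  proof (cases "t = 0")
    case False
    then have "1 \<le> t" by simp
    then show ?thesis using * U_bounded_iff by blast
  qed simp
next
  assume "\<exists>c. \<forall>j m. m + c < j \<longrightarrow> t \<le> D j m"
  then obtain c where c: "\<And>j m. m + c < j \<Longrightarrow> t \<le> D j m" by blast
  show "\<forall>s. 1 \<le> s \<and> s \<le> t \<longrightarrow> U_bounded s k K"
  proof (intro allI impI)
    fix s assume s: "1 \<le> s \<and> s \<le> t"
    then have "\<forall>j m. m + c < j \<longrightarrow> s \<le> D j m" using c by (meson order_trans)
    then show "U_bounded s k K" using U_bounded_iff[of s] s by blast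
  qed
qed

lemma Ilqm_eq_iff:
  assumes st: "stable t e"
  shows "Ilqm k K = Suc t \<longleftrightarrow> (\<forall>s. 1 \<le> s \<and> s \<le> t \<longrightarrow> U_bounded s k K)"
proof
  assume eq: "Ilqm k K = Suc t"
  show "\<forall>s. 1 \<le> s \<and> s \<le> t \<longrightarrow> U_bounded s k K"
  proof (intro allI impI)
    fix s assume s: "1 \<le> s \<and> s \<le> t"
    then have "s < Ilqm k K" using eq by simp
    then show "U_bounded s k K" using not_less_Least[of s "\<lambda>s. 1 \<le> s \<and> \<not> U_bounded s k K"] s
      unfolding Ilqm_def by blast
  qed
next
  assume *: "\<forall>s. 1 \<le> s \<and> s \<le> t \<longrightarrow> U_bounded s k K"
  show "Ilqm k K = Suc t"
    unfolding Ilqm_def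
  proof (rule Least_equality)
    show "1 \<le> Suc t \<and> \<not> U_bounded (Suc t) k K" using not_U_bounded_Suc[OF st] by simp
    show "Suc t \<le> s" if "1 \<le> s \<and> \<not> U_bounded s k K" for s
      using * that not_less_eq_eq by blast
  qed
qed

end

section \<open>Modularity and degrees\<close>

text \<open>\<open>A'\<close> stands for the possibly infinite field K^(p^n), \<open>A\<close> for a
  finite piece of it: a \<open>C\<close>-basis of \<open>A\<close> spans the compositum over
  \<open>B\<close> and, by disjointness, stays independent there.\<close>

lemma deg_eq_if_lin_disjoint:
  fixes C :: "'a::field set"
  assumes p: "CHAR('a) > 0" and C: "subfield C" and A: "subfield A" and B: "subfield B"
    and CB: "C \<subseteq> B" and fin: "findim C A" and pi: "A \<subseteq> pi_elems B"
    and ld: "lin_disjoint C A' B" and AA': "A \<subseteq> A'"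
  shows "deg B (gen B A) = deg C A"
proof -
  obtain S where S: "finite S" "card S = deg C A" "lin_indep_over C S" "A = span_over C S"
    by (rule vdimE[OF findim_vdim[OF C fin]])
  have "S \<subseteq> A'" using span_over_subset[OF C S(1)] S(4) AA' by blast
  then have "lin_indep_over B S" using ld S(3) unfolding lin_disjoint_def by simp
  then have "vdim (card S) B (gen B A)"
    by (rule vdimI[OF S(1) refl _ gen_compositum_span_over[OF p C B A CB S(1,4) pi]])
  then show ?thesis using deg_eqI[OF B] S(2) by simp
qed

text \<open>The converse at finite level: extend \<open>S\<close> to a \<open>C\<close>-basis of
  \<open>A\<close>. It spans the compositum over \<open>B\<close> and has no more elements than the
  degree, so it is independent over \<open>B\<close>.\<close>

lemma lin_indep_over_if_deg_eq:
  fixes C :: "'a::field set"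
  assumes p: "CHAR('a) > 0" and C: "subfield C" and A: "subfield A" and B: "subfield B"
    and CB: "C \<subseteq> B" and fin: "findim C A" and pi: "A \<subseteq> pi_elems B"
    and deg: "deg C A \<le> deg B (gen B A)" and S: "S \<subseteq> A" "lin_indep_over C S"
  shows "lin_indep_over B S"
proof -
  obtain S' where S': "S \<subseteq> S'" "finite S'" "card S' = deg C A" "lin_indep_over C S'" "A = span_over C S'"
    by (rule vdim_extend_basis[OF C findim_vdim[OF C fin] S(2,1)])
  obtain n where n: "vdim n B (span_over B S')" "n < card S' \<or> n = card S' \<and> lin_indep_over B S'"
    by (rule vdim_span_over[OF B S'(2)])
  have "deg B (gen B A) = n"
    unfolding gen_compositum_span_over[OF p C B A CB S'(2,5) pi] by (rule deg_eqI[OF B n(1)])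
  then have "lin_indep_over B S'" using n(2) deg S'(3) by auto
  then show ?thesis using S'(1) by (rule lin_indep_over_mono)
qed

lemma fpi_if_finite_ext:
  fixes k :: "'a::field set"
  assumes p: "CHAR('a) > 0" and k: "subfield k" and L: "subfield L" "k \<subseteq> L" "L \<subseteq> pi_elems k"
    and fin: "finite_ext k L"
  shows "fpi k L"
proof -
  obtain B where B: "finite B" "B \<subseteq> L" "L \<subseteq> span_over k B" using fin unfolding finite_ext_def by blast
  have "L \<subseteq> gen k B" using B(3) span_over_least[OF subfield_gen gen_base gen_superset, of k B] by blast
  then have "gen k B = L" by (rule gen_eqI[OF L(1,2) B(2)])
  then show ?thesis using fpi_gen[OF p k B(1)] B(2) L(3) by (metis order_trans)
qed

lemma finite_ext_if_fpi:
  assumes L: "fpi k L" shows "finite_ext k L"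
proof -
  obtain B where B: "finite B" "card B = deg k L" "lin_indep_over k B" "L = span_over k B"
    by (rule vdimE[OF findim_vdim[OF fpiD(1,5)[OF L]]])
  then show ?thesis
    using span_over_subset[OF fpiD(1)[OF L] B(1)] unfolding finite_ext_def by blast
qed

context qext
begin

section \<open>Change of the base field inside K\<close>

lemma kn_base_change:
  assumes L: "fpi k L" "L \<subseteq> K" and e: "ppow L e \<subseteq> k"
  shows "kn k K j \<subseteq> kn L K j" "kn L K j \<subseteq> kn k K (j + e)"
proof -
  show "kn k K j \<subseteq> kn L K j" using fpiD(3)[OF L(1)] by (auto simp: kn_def proot_def)
  show "kn L K j \<subseteq> kn k K (j + e)"
    using e by (auto simp: kn_def proot_def ppow_def power_add power_mult)
qed

lemma qext_base_change:
  assumes L: "fpi k L" "L \<subseteq> K"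
  shows "qext L K d"
proof
  show "CHAR('a) > 0" "subfield L" "subfield K" "L \<subseteq> K" using p fpiD[OF L(1)] K L(2) by simp_all
  show "K \<subseteq> pi_elems L" using Kpi pi_elems_mono[OF fpiD(3)[OF L(1)]] by blast
  obtain e where e: "ppow L e \<subseteq> k" by (rule fpi_exponent[OF p L(1)])
  fix j
  note bc = prank_base_change[OF p fpi_kn fpiD(2,3)[OF L(1)], of "j + e"]
  have sub: "subfield (kn L K j)" "L \<subseteq> kn L K j" "kn L K j \<subseteq> gen L (kn k K (j + e))"
  proof -
    show "subfield (kn L K j)" by (rule subfield_kn[OF p fpiD(2)[OF L(1)] K])
    show "L \<subseteq> kn L K j"
      using L(2) proot_mono[OF fpiD(2)[OF L(1)], of 0 j] by (auto simp: kn_def proot_def)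
    show "kn L K j \<subseteq> gen L (kn k K (j + e))"
      using kn_base_change(2)[OF L e] gen_superset by blast
  qed
  show "fpi L (kn L K j)" by (rule fpi_intermediate(1)[OF bc(1) sub])
  show "prank L (kn L K j) \<le> d"
    using prank_mono[OF p bc(1) sub] bc(2) prank_kn[of "j + e"] by simp
qed

text \<open>First bound: raising minimal generators over \<open>L\<close> to the power p^e sends the
  coefficients from \<open>L\<close> into \<open>k\<close>, so these powers generate a field over
  \<open>k\<close> containing E j (m+e). Second bound: the j-th stage over \<open>L\<close> lies in
  k_(j+e), and base change does not increase rank.\<close>

lemma D_base_change:
  assumes L: "fpi k L" "L \<subseteq> K" and e: "ppow L e \<subseteq> k"
  shows "D j (m + e) \<le> qext.D L K j m" "qext.D L K j m \<le> D (j + e) m"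
proof -
  interpret L: qext L K d by (rule qext_base_change[OF L])
  note bc = kn_base_change[OF L e]
  show "D j (m + e) \<le> L.D j m"
  proof -
    obtain G where G: "finite G" "G \<subseteq> L.E j m" "gen L G = L.E j m" "card G = prank L (L.E j m)"
      by (rule prank_minimal_generators[OF p L.fpi_E])
    have GK: "ppow G e \<subseteq> pi_elems k"
      using ppow_mono[OF G(2), of e] ppow_subset[OF L.subfield_E, of j m e] L.E_subset_kn[of j m]
        L.kn_subset[of j] Kpi by blast
    have 1: "ppow (L.E j m) e \<subseteq> gen k (ppow G e)"
      unfolding G(3)[symmetric]
      using e gen_base[of k "ppow G e"] by (intro ppow_gen_subset[OF p subfield_gen] gen_superset) auto
    have "ppow (kn k K j) m \<subseteq> L.E j m"
      using ppow_mono[OF bc(1), of j m] gen_superset[of "ppow (kn L K j) m" L] unfolding L.E_def by blast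
    then have "ppow (kn k K j) (m + e) \<subseteq> ppow (L.E j m) e"
      using ppow_mono[of "ppow (kn k K j) m" _ e] by (simp add: ppow_ppow)
    then have "E j (m + e) \<subseteq> gen k (ppow G e)"
      unfolding E_def using 1 by (intro gen_least[OF subfield_gen gen_base]) blast
    then have "D j (m + e) \<le> prank k (gen k (ppow G e))"
      unfolding D_def
      by (rule prank_mono[OF p prank_gen_ppow_le_card(1)[OF p k G(1) GK] subfield_E k_subset_E])
    also have "\<dots> \<le> card G" by (rule prank_gen_ppow_le_card(2)[OF p k G(1) GK])
    finally show ?thesis unfolding L.D_def G(4) .
  qed
  show "L.D j m \<le> D (j + e) m"
  proof -
    note bce = prank_base_change[OF p fpi_E fpiD(2,3)[OF L(1)], of "j + e" m]
    have "ppow (kn L K j) m \<subseteq> E (j + e) m"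
      using ppow_mono[OF bc(2), of j m] gen_superset[of "ppow (kn k K (j + e)) m" k] unfolding E_def by blast
    then have "L.E j m \<subseteq> gen L (E (j + e) m)"
      unfolding L.E_def by (intro gen_mono order_refl)
    then have "L.D j m \<le> prank L (gen L (E (j + e) m))"
      unfolding L.D_def by (rule prank_mono[OF p bce(1) L.subfield_E L.k_subset_E])
    also have "\<dots> \<le> D (j + e) m" unfolding D_def by (rule bce(2))
    finally show ?thesis .
  qed
qed

text \<open>The base field in the definition of modularity is a Frobenius image, so degrees over it
  can be pulled back to degrees over k_m.\<close>

lemma Int_ppow_K: "k \<inter> ppow K m = ppow (kn k K m) m"
  by (auto simp: kn_def proot_def ppow_def)

lemma fpi_kn_kn: "i \<le> j \<Longrightarrow> fpi (kn k K i) (kn k K j)"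
  by (rule fpi_intermediate(2)[OF fpi_kn fpiD(2,3)[OF fpi_kn] kn_mono])

lemma ppow_kn_setup:
  assumes mj: "m \<le> j"
  shows "subfield (ppow (kn k K m) m)" "subfield (ppow (kn k K j) m)" "ppow (kn k K m) m \<subseteq> k"
    "findim (ppow (kn k K m) m) (ppow (kn k K j) m)" "ppow (kn k K j) m \<subseteq> pi_elems k"
    "deg (ppow (kn k K m) m) (ppow (kn k K j) m) = deg (kn k K m) (kn k K j)"
    "ppow (kn k K j) m \<subseteq> ppow K m"
proof -
  note f = fpi_kn_kn[OF mj]
  show "subfield (ppow (kn k K m) m)" "subfield (ppow (kn k K j) m)"
    using subfield_ppow[OF p] fpiD(1,2)[OF f] by auto
  show "ppow (kn k K m) m \<subseteq> k" using ppow_kn[of 0 m] by simp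
  show "findim (ppow (kn k K m) m) (ppow (kn k K j) m)"
    "deg (ppow (kn k K m) m) (ppow (kn k K j) m) = deg (kn k K m) (kn k K j)"
    using deg_ppow[OF p fpiD(1,5)[OF f]] by auto
  show "ppow (kn k K j) m \<subseteq> ppow K m" by (rule ppow_mono[OF kn_subset])
  then show "ppow (kn k K j) m \<subseteq> pi_elems k" using ppow_subset[OF K, of m] Kpi by blast
qed

lemma deg_E_if_modular:
  assumes mod: "modular k K" and mj: "m \<le> j"
  shows "deg k (E j m) = deg (kn k K m) (kn k K j)"
proof -
  note s = ppow_kn_setup[OF mj]
  have "lin_disjoint (ppow (kn k K m) m) (ppow K m) k"
    using mod unfolding modular_def Int_ppow_K[symmetric] by blast
  then have "deg k (gen k (ppow (kn k K j) m)) = deg (ppow (kn k K m) m) (ppow (kn k K j) m)"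
    by (rule deg_eq_if_lin_disjoint[OF p s(1,2) k s(3,4,5) _ s(7)])
  then show ?thesis using s(6) unfolding E_def by simp
qed

text \<open>Divide \<open>deg_E_if_modular\<close> for m by the same formula for m + 1. The
  right-hand side does not mention \<open>j\<close>.\<close>

lemma D_eq_if_modular:
  assumes mod: "modular k K" and m: "m < j"
  shows "CHAR('a) ^ D j m = deg (kn k K m) (kn k K (Suc m))"
proof -
  have sf: "subfield (kn k K i)" for i by (rule fpiD(2)[OF fpi_kn])
  have "deg k (E j m) = deg k (E j (Suc m)) * deg (E j (Suc m)) (E j m)"
    by (rule deg_tower[OF k subfield_E subfield_E k_subset_E E_antimono fpiD(5)[OF fpi_E]]) simp
  moreover have "deg (kn k K m) (kn k K j) = deg (kn k K m) (kn k K (Suc m)) * deg (kn k K (Suc m)) (kn k K j)"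
    by (rule deg_tower[OF sf sf sf kn_mono kn_mono fpiD(5)[OF fpi_kn_kn]]) (use m in auto)
  moreover have "deg k (E j (Suc m)) > 0" by (rule deg_pos[OF k subfield_E fpiD(5)[OF fpi_E]])
  ultimately show ?thesis
    using deg_E_if_modular[OF mod, of m j] deg_E_if_modular[OF mod, of "Suc m" j] m deg_E_Suc[of j m] by simp
qed

text \<open>Shift to \<open>L\<close>, move freely in the first index there by modularity, and shift
  back: t <= D i (m+c) <= L.D i m = L.D (j-c) m <= D j m.\<close>

lemma D_ge_if_modular_over:
  assumes st: "stable t e" and L: "fpi k L" "L \<subseteq> K" and mod: "modular L K"
  shows "\<exists>c. \<forall>j m. m + c < j \<longrightarrow> t \<le> D j m"
proof -
  interpret L: qext L K d by (rule qext_base_change[OF L])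
  obtain c where c: "ppow L c \<subseteq> k" by (rule fpi_exponent[OF p L(1)])
  have "t \<le> D j m" if mj: "m + c < j" for j m
  proof -
    obtain j0 where j0: "\<forall>j\<ge>j0. t \<le> D j (m + c)" using D_eventually_ge[OF st] by blast
    \<comment> \<open>Beyond \<open>j0\<close> the rank has reached t; \<open>Suc m\<close> ensures
      m < i, as \<open>L.D_eq_if_modular\<close> requires. For \<open>j - c\<close> the same
      inequality is the assumption \<open>mj\<close>.\<close>
    define i where "i = max j0 (Suc m)"
    have "t \<le> D i (m + c)" using j0 by (simp add: i_def)
    also have "\<dots> \<le> L.D i m" by (rule D_base_change(1)[OF L c])
    also have "L.D i m = L.D (j - c) m"
    proof -
      have "CHAR('a) ^ L.D i m = CHAR('a) ^ L.D (j - c) m"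
        using L.D_eq_if_modular[OF mod, of m i] L.D_eq_if_modular[OF mod, of m "j - c"] mj
        by (simp add: i_def)
      then show ?thesis using prime_gt_1_nat[OF prime_CHAR_semidom[OF p]] by simp
    qed
    also have "\<dots> \<le> D j m" using D_base_change(2)[OF L c, of "j - c" m] mj by simp
    finally show ?thesis .
  qed
  then show ?thesis by blast
qed

section \<open>Finding a base over which K is modular\<close>

lemma kn_kn: "kn (kn k K i) K j = kn k K (i + j)"
proof -
  have "(x ^ (CHAR('a) ^ j)) ^ (CHAR('a) ^ i) = x ^ (CHAR('a) ^ (i + j))" for x :: 'a
    by (simp only: power_mult[symmetric] power_add mult.commute)
  then show ?thesis using subfieldD(9)[OF K] by (auto simp: kn_def proot_def)
qed

lemma ppow_K_eq_Union: "ppow K n = (\<Union>j. ppow (kn k K j) n)"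
  unfolding ppow_def by (subst K_eq_Union_kn) (simp add: image_UN)

text \<open>In [k_j : k] = p^(tj) the factor [k_j : E j n] is at most p^(tn) by the rank bound, so
  [E j n : k] is at least p^(t(j-n)) = [k_j : k_n]. That is the degree inequality needed for linear
  disjointness at level n.\<close>

lemma modular_if_deg_kn:
  assumes rank: "\<And>j. prank k (kn k K j) \<le> t" and deg: "\<And>j. deg k (kn k K j) = CHAR('a) ^ (t * j)"
  shows "modular k K"
  unfolding modular_def
proof
  fix n
  show "lin_disjoint (k \<inter> ppow K n) (ppow K n) k"
    unfolding lin_disjoint_def Int_ppow_K
  proof (intro allI impI)
    fix S assume S: "S \<subseteq> ppow K n" "lin_indep_over (ppow (kn k K n) n) S"
    show "lin_indep_over k S"
    \<comment> \<open>Independence has finite character, and a finite subset already lives in some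
      (k_j)^(p^n), where degrees are available.\<close>
    proof (rule lin_indep_over_finite_subsets)
      fix S' assume S': "finite S'" "S' \<subseteq> S"
      have "S' \<subseteq> (\<Union>j. ppow (kn k K j) n)"
        using S'(2) S(1) unfolding ppow_K_eq_Union by (rule order_trans)
      then have "\<exists>j. S' \<subseteq> ppow (kn k K j) n"
        by (rule finite_subset_chain_Union[OF S'(1)]) (intro ppow_mono kn_mono)
      then obtain j0 where j0: "S' \<subseteq> ppow (kn k K j0) n" ..
      define j where "j = max j0 n"
      have nj: "n \<le> j" by (simp add: j_def)
      have S'j: "S' \<subseteq> ppow (kn k K j) n" using j0 ppow_mono[OF kn_mono, of j0 j n] by (auto simp: j_def)
      note s = ppow_kn_setup[OF nj]
      have p1: "CHAR('a) > 1" using prime_gt_1_nat[OF prime_CHAR_semidom[OF p]] .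
      have "CHAR('a) ^ (t * j) = deg k (E j n) * deg (E j n) (kn k K j)"
        using deg_tower[OF k subfield_E fpiD(2)[OF fpi_kn] k_subset_E E_subset_kn fpiD(5)[OF fpi_kn], of j n] deg[of j]
        by simp
      also have "deg (E j n) (kn k K j) = CHAR('a) ^ (\<Sum>i<n. D j i)"
        using deg_E_E[of j 0 n] by (simp add: E_0)
      also have "(\<Sum>i<n. D j i) \<le> t * n"
      proof -
        have "D j i \<le> t" for i using D_antimono[of 0 i j] rank[of j] by (simp add: D_def E_0)
        then show ?thesis using sum_bounded_above[of "{..<n}" "D j" t] by (simp add: mult.commute)
      qed
      then have "deg k (E j n) * CHAR('a) ^ (\<Sum>i<n. D j i) \<le> deg k (E j n) * CHAR('a) ^ (t * n)"
        using p1 by (intro mult_left_mono power_increasing) auto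
      finally have le: "CHAR('a) ^ (t * j) \<le> deg k (E j n) * CHAR('a) ^ (t * n)" .
      have "CHAR('a) ^ (t * n) * deg (kn k K n) (kn k K j) = CHAR('a) ^ (t * j)"
        using deg_tower[OF k fpiD(2)[OF fpi_kn] fpiD(2)[OF fpi_kn] fpiD(3)[OF fpi_kn] kn_mono[OF nj] fpiD(5)[OF fpi_kn]]
          deg by simp
      then have "deg (kn k K n) (kn k K j) * CHAR('a) ^ (t * n) \<le> deg k (E j n) * CHAR('a) ^ (t * n)"
        using le by (simp add: mult.commute)
      then have "deg (kn k K n) (kn k K j) \<le> deg k (E j n)" using p by simp
      then have "deg (ppow (kn k K n) n) (ppow (kn k K j) n) \<le> deg k (gen k (ppow (kn k K j) n))"
        using s(6) by (simp add: E_def)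
      then show "lin_indep_over k S'"
        by (rule lin_indep_over_if_deg_eq[OF p s(1,2) k s(3,4,5) _ S'j lin_indep_over_mono[OF S(2) S'(2)]])
    qed
  qed
qed

text \<open>With R = k(K^(p^e)), the degree [R(k_j) : R] is at most [k_j : E j e], hence at most
  p^(ed) uniformly in j. An index of maximal degree already captures every k_j.\<close>

lemma kn_subset_gen_rp:
  obtains i where "\<And>j. kn k K j \<subseteq> gen (gen k (ppow K e)) (kn k K i)"
proof -
  let ?R = "gen k (ppow K e)"
  let ?N = "\<lambda>j. gen ?R (kn k K j)"
  have comp: "findim ?R (?N j)" "deg ?R (?N j) \<le> CHAR('a) ^ (e * d)" for j
  proof -
    have f: "fpi (E j e) (kn k K j)" using fpi_E_E[of 0 e j] by (simp add: E_0)
    have ER: "E j e \<subseteq> ?R" unfolding gen_ppow_eq_Union_E by blast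
    have pi: "kn k K j \<subseteq> pi_elems ?R"
      using kn_subset[of j] Kpi pi_elems_mono[OF gen_base, of k "ppow K e"] by blast
    note c = deg_compositum_le[OF p subfield_E subfield_gen fpiD(2)[OF f] ER fpiD(5)[OF f] pi]
    show "findim ?R (?N j)" by (rule c(1))
    note c(2)
    also have "deg (E j e) (kn k K j) = CHAR('a) ^ (\<Sum>i<e. D j i)"
      using deg_E_E[of j 0 e] by (simp add: E_0)
    also have "\<dots> \<le> CHAR('a) ^ (e * d)"
      using sum_bounded_above[of "{..<e}" "D j" d] D_le p by (intro power_increasing) auto
    finally show "deg ?R (?N j) \<le> CHAR('a) ^ (e * d)" .
  qed
  have "\<exists>i. \<forall>j. deg ?R (?N j) \<le> deg ?R (?N i)"
    using ex_has_greatest_nat[of "\<lambda>_. True" 0 "\<lambda>j. deg ?R (?N j)" "Suc (CHAR('a) ^ (e * d))"] comp(2)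
    by (auto simp: less_Suc_eq_le)
  then obtain i where i: "\<And>j. deg ?R (?N j) \<le> deg ?R (?N i)" by blast
  have "kn k K j \<subseteq> ?N i" for j
  proof -
    define m where "m = max i j"
    have sub: "?N i \<subseteq> ?N m" by (intro gen_mono kn_mono order_refl) (simp add: m_def)
    have fin: "findim (?N i) (?N m)"
      by (rule findim_intermediate(2)[OF subfield_gen subfield_gen subfield_gen gen_base sub comp(1)])
    have "deg ?R (?N i) * deg (?N i) (?N m) \<le> deg ?R (?N i)"
      using i[of m] deg_tower[OF subfield_gen subfield_gen subfield_gen gen_base sub comp(1)] by simp
    moreover have "deg ?R (?N i) > 0" by (rule deg_pos[OF subfield_gen subfield_gen comp(1)])
    moreover have "deg (?N i) (?N m) > 0" by (rule deg_pos[OF subfield_gen subfield_gen fin])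
    ultimately have "deg (?N i) (?N m) = 1" by simp
    then have "?N m = ?N i" by (rule eq_if_deg_eq_1[OF subfield_gen subfield_gen sub fin])
    then show ?thesis using kn_mono[of j m] gen_superset[of "kn k K m" ?R] by (auto simp: m_def)
  qed
  then show thesis by (rule that)
qed

text \<open>For l >= i the field k_l contains k_i, so K is generated over k_l by rp(K/k). Finitely
  many generators of k_(l+j) then lie in the compositum of k_l with one E m e, whose rank is at most
  D m e <= t.\<close>

lemma prank_kn_kn_le:
  assumes st: "stable t e" and i: "\<And>j. kn k K j \<subseteq> gen (gen k (ppow K e)) (kn k K i)" and il: "i \<le> l"
  shows "prank (kn k K l) (kn k K (l + j)) \<le> t"
proof -
  let ?F = "kn k K l"
  have F: "subfield ?F" "k \<subseteq> ?F" using fpiD(2,3)[OF fpi_kn] by auto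
  obtain G where G: "finite G" "G \<subseteq> kn k K (l + j)" "gen k G = kn k K (l + j)"
    by (rule fpi_generators[OF fpi_kn])
  have "gen (gen k (ppow K e)) (kn k K i) \<subseteq> (\<Union>m. gen ?F (E m e))"
  proof (rule gen_least)
    show "subfield (\<Union>m. gen ?F (E m e))"
      by (rule subfield_chain_Union) (use gen_mono[OF order_refl E_mono] in auto)
    show "gen k (ppow K e) \<subseteq> (\<Union>m. gen ?F (E m e))"
      unfolding gen_ppow_eq_Union_E using gen_superset[of "E m e" ?F for m] by blast
    show "kn k K i \<subseteq> (\<Union>m. gen ?F (E m e))"
      using kn_mono[OF il] gen_base[of ?F "E 0 e"] by blast
  qed
  then have "G \<subseteq> (\<Union>m. gen ?F (E m e))" using G(2) i[of "l + j"] by blast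
  then have "\<exists>m. G \<subseteq> gen ?F (E m e)"
    by (rule finite_subset_chain_Union[OF G(1)]) (intro gen_mono E_mono order_refl)
  then obtain m where m: "G \<subseteq> gen ?F (E m e)" ..
  have "k \<subseteq> gen ?F (E m e)" using F(2) gen_base[of ?F "E m e"] by blast
  then have sub: "kn k K (l + j) \<subseteq> gen ?F (E m e)"
    unfolding G(3)[symmetric] using m by (rule gen_least[OF subfield_gen])
  note bc = prank_base_change[OF p fpi_E F, of m e]
  have "prank ?F (kn k K (l + j)) \<le> prank ?F (gen ?F (E m e))"
    by (rule prank_mono[OF p bc(1) fpiD(2)[OF fpi_kn] kn_mono sub]) simp
  also have "\<dots> \<le> D m e" unfolding D_def by (rule bc(2))
  also have "\<dots> \<le> t" using st unfolding stable_def by blast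
  finally show ?thesis .
qed

text \<open>Because (k_(j+1))^p lies in k_j, the rank of k_(j+1)/k_j is the full logarithm of its
  degree.\<close>

lemma sum_D_Suc_le:
  assumes rank: "prank (kn k K j) (kn k K (Suc j)) \<le> t"
  shows "(\<Sum>i<Suc j. D (Suc j) i) \<le> (\<Sum>i<j. D j i) + t"
proof -
  have f: "fpi (kn k K j) (kn k K (Suc j))" by (rule fpi_kn_kn) simp
  have "gen (kn k K j) (ppow (kn k K (Suc j)) 1) = kn k K j"
    using ppow_kn[of j 1] by (intro gen_absorb fpiD(1)[OF f]) simp
  then have "deg (kn k K j) (kn k K (Suc j)) = CHAR('a) ^ prank (kn k K j) (kn k K (Suc j))"
    using deg_prank[OF p f] by simp
  moreover have "deg k (kn k K (Suc j)) = deg k (kn k K j) * deg (kn k K j) (kn k K (Suc j))"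
    by (rule deg_tower[OF k fpiD(1,2)[OF f] fpiD(3)[OF fpi_kn] fpiD(3)[OF f] fpiD(5)[OF fpi_kn]])
  ultimately have "CHAR('a) ^ (\<Sum>i<Suc j. D (Suc j) i) =
      CHAR('a) ^ ((\<Sum>i<j. D j i) + prank (kn k K j) (kn k K (Suc j)))"
    by (simp only: deg_kn power_add)
  then have "(\<Sum>i<Suc j. D (Suc j) i) = (\<Sum>i<j. D j i) + prank (kn k K j) (kn k K (Suc j))"
    using prime_gt_1_nat[OF prime_CHAR_semidom[OF p]] by (simp del: sum.lessThan_Suc)
  then show ?thesis using rank by simp
qed

lemma modular_kn_if_D_ge:
  assumes st: "stable t e" and D_ge: "\<And>j m. m + c < j \<Longrightarrow> t \<le> D j m"
  shows "\<exists>j. modular (kn k K j) K"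
proof -
  obtain i where i: "\<And>j. kn k K j \<subseteq> gen (gen k (ppow K e)) (kn k K i)"
    using kn_subset_gen_rp[of e] by blast
  \<comment> \<open>By \<open>deg_kn\<close> this is the logarithm to base p of [k_j : k].\<close>
  define N where "N j = (\<Sum>i<j. D j i)" for j
  have N_Suc: "N (Suc j) \<le> N j + t" if "i \<le> j" for j
    unfolding N_def using prank_kn_kn_le[OF st i that, of 1] by (intro sum_D_Suc_le) simp
  have N_ge: "t * j \<le> N j + t * c" for j
  proof -
    have "t * (j - c) = (\<Sum>i<j - c. t)" by simp
    also have "\<dots> \<le> (\<Sum>i<j - c. D j i)" by (intro sum_mono D_ge) auto
    also have "\<dots> \<le> N j" unfolding N_def by (intro sum_mono2) auto
    finally have "t * (j - c) \<le> N j" .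
    moreover have "t * j \<le> t * (j - c) + t * c"
      unfolding add_mult_distrib2[symmetric] by (rule mult_le_mono2) simp
    ultimately show ?thesis by simp
  qed
  \<comment> \<open>The summand \<open>t * c\<close> keeps the subtraction of naturals from
    truncating, by \<open>N_ge\<close>. Minimality of \<open>h\<close> at \<open>l\<close> gives the
    lower bound on N (l + j), and iterating \<open>N_Suc\<close> gives the upper one.\<close>
  define h where "h j = N j + t * c - t * j" for j
  obtain l where l: "i \<le> l" "\<And>j. i \<le> j \<Longrightarrow> h l \<le> h j"
    using ex_has_least_nat[of "\<lambda>j. i \<le> j" i h] by auto
  have N_eq: "N (l + j) = N l + t * j" for j
  proof (rule antisym)
    show "N (l + j) \<le> N l + t * j"
    proof (induction j)
      case (Suc j)
      then show ?case using N_Suc[of "l + j"] l(1) by simp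
    qed simp
    have "h l \<le> h (l + j)" using l by simp
    then show "N l + t * j \<le> N (l + j)"
      using N_ge[of l] N_ge[of "l + j"] unfolding h_def by (simp add: algebra_simps)
  qed
  let ?F = "kn k K l"
  interpret F: qext ?F K d by (rule qext_base_change[OF fpi_kn kn_subset])
  have "modular ?F K"
  proof (rule F.modular_if_deg_kn)
    fix j
    show "prank ?F (kn ?F K j) \<le> t"
      unfolding kn_kn by (rule prank_kn_kn_le[OF st i l(1)])
    have "deg k (kn k K (l + j)) = deg k ?F * deg ?F (kn k K (l + j))"
      by (rule deg_tower[OF k fpiD(2)[OF fpi_kn] fpiD(2)[OF fpi_kn] fpiD(3)[OF fpi_kn] kn_mono fpiD(5)[OF fpi_kn]]) simp
    then have "CHAR('a) ^ N l * CHAR('a) ^ (t * j) = CHAR('a) ^ N l * deg ?F (kn k K (l + j))"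
      using N_eq[of j] unfolding deg_kn N_def by (simp add: power_add)
    then show "deg ?F (kn ?F K j) = CHAR('a) ^ (t * j)"
      unfolding kn_kn using p by simp
  qed
  then show ?thesis ..
qed

end

section \<open>From q-finiteness to the equivalences\<close>

lemma qext_if_q_finite:
  fixes k K :: "'a::field set"
  assumes p: "CHAR('a) > 0" and k: "subfield k" and K: "subfield K" "k \<subseteq> K"
    and pi: "purely_inseparable k K" and qf: "q_finite k K"
  obtains d where "qext k K d"
proof -
  have Kpi: "K \<subseteq> pi_elems k" using pi purely_inseparable_iff by blast
  obtain d where d: "di k K = enat d" using qf unfolding q_finite_def by auto
  have le: "mgs_card k (kn k K n) \<le> enat d" for n
    unfolding d[symmetric] di_def by (rule SUP_upper) simp
  have f: "fpi k (kn k K n)" for n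
  proof (rule fpi_if_mgs_card_finite[OF p k])
    show "kn k K n \<subseteq> pi_elems k" using Kpi by (auto simp: kn_def)
    show "mgs_card k (kn k K n) < \<infinity>" using le[of n] by (metis enat_ord_simps(4) infinity_ileE)
  qed
  have "qext k K d"
  proof
    show "prank k (kn k K j) \<le> d" for j
      using le[of j] unfolding mgs_card_eq_prank[OF p f] by simp
  qed (use p k K Kpi f in auto)
  then show thesis by (rule that)
qed

theorem mainTheorem1:
  fixes k K :: "'a::field set"
  assumes char_pos: "CHAR('a) > 0"
    and alg_closed: "\<forall>q::'a poly. degree q > 0 \<longrightarrow> (\<exists>x. poly q x = 0)"
    and alg_over_k: "\<forall>x::'a. \<exists>q. q \<noteq> 0 \<and> (\<forall>i. coeff q i \<in> k) \<and> poly q x = 0"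
    and k_field: "subfield k"
    and ext: "subfield K" "k \<subseteq> K"
    and pi: "purely_inseparable k K"
    and qf: "q_finite k K"
    and unb: "\<not> bounded_exponent k K"
  defines "t \<equiv> di k (rp k K)"
  shows "(lq_modular k K \<longleftrightarrow> (\<exists>j. modular (kn k K j) K))
       \<and> ((\<exists>j. modular (kn k K j) K) \<longleftrightarrow> (\<forall>s::nat. 1 \<le> s \<and> enat s \<le> t \<longrightarrow> U_bounded s k K))
       \<and> ((\<forall>s::nat. 1 \<le> s \<and> enat s \<le> t \<longrightarrow> U_bounded s k K) \<longleftrightarrow> enat (Ilqm k K) = t + 1)"
proof -
  obtain d where "qext k K d" by (rule qext_if_q_finite[OF char_pos k_field ext pi qf])
  then interpret qext k K d .
  obtain r e where st: "stable r e" using stable_exists by blast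
  have t: "t = enat r" unfolding t_def by (rule di_rp[OF st])
  let ?C = "\<exists>c. \<forall>j m. m + c < j \<longrightarrow> r \<le> D j m"
  \<comment> \<open>Each k_j is itself a finite subextension of K/k and can serve as the
    base.\<close>
  have one_if_two: "lq_modular k K" if "modular (kn k K j) K" for j
    using that qf finite_ext_if_fpi[OF fpi_kn] fpiD(2,3)[OF fpi_kn] kn_subset[of j]
    unfolding lq_modular_def intermediate_def by blast
  have C_if_one: "?C" if lq: "lq_modular k K"
  proof -
    obtain L where L: "intermediate k L K" "finite_ext k L" "modular L K"
      using lq unfolding lq_modular_def by blast
    then have "fpi k L"
      using Kpi by (intro fpi_if_finite_ext[OF p k_field]) (auto simp: intermediate_def)
    then show ?thesis using L by (intro D_ge_if_modular_over[OF st]) (auto simp: intermediate_def)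
  qed
  have two_if_C: "\<exists>j. modular (kn k K j) K" if "?C"
    using that modular_kn_if_D_ge[OF st] by blast
  have three_iff_C: "(\<forall>s::nat. 1 \<le> s \<and> enat s \<le> t \<longrightarrow> U_bounded s k K) \<longleftrightarrow> ?C"
    unfolding t using U_bounded_upto_iff[of r] by simp
  have four_iff_C: "enat (Ilqm k K) = t + 1 \<longleftrightarrow> ?C"
    unfolding t using Ilqm_eq_iff[OF st] U_bounded_upto_iff[of r] by (simp add: one_enat_def)
  from one_if_two C_if_one two_if_C three_iff_C four_iff_C show ?thesis by blast
qed

end
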